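(* Let $d,r$ be integers with $d\ge 2$ and $1\leq r\leq \frac{d+1}{2}$. The variety $\mathrm{WE}_{1,r}^d$ is irreducible.
   Context: Work over $\mathbb{C}$ and identify $\mathrm{Sym}^d(\mathbb{C}^{n+1})$ with the space $\mathbb{C}[x_0,\dots,x_n]_d$ of degree-$d$ forms. A linear form $L=a_0x_0+\dots+a_nx_n$ is identified with its coefficient vector $(a_0,\dots,a_n)\in\mathbb{C}^{n+1}$. The Veronese variety $V_n^d\subset\mathbb{P}(\mathrm{Sym}^d(\mathbb{C}^{n+1}))$ is the set of $[L^d]$ with $L$ a nonzero linear form. Set $\sigma_r^\circ(V_n^d)=\bigcup_{p_1,\dots,p_r\in V_n^d}\langle p_1,\dots,p_r\rangle$ (unions of projective linear spans). The Waring rank $\mathrm{rk}(F)$ of a form $F$ is the minimal $r$ such that $F=\sum_{i=1}^rL_i^d$ for linear forms $L_i$. The Waring locus $\mathcal{W}(F)$ is the set of $[L]\in\mathbb{P}(\mathrm{Sym}^1(\mathbb{C}^{n+1}))$ such that $F\in\langle L^d,L_2^d,\dots,L_r^d\rangle$ for some linear forms $L_2,\dots,L_r$, where $r=\mathrm{rk}(F)$. The eigenscheme $\mathrm{Eig}(F)\subset\mathbb{P}(\mathrm{Sym}^1(\mathbb{C}^{n+1}))$ is the scheme defined by the vanishing of the $2\times2$ minors of the $2\times(n+1)$ matrix with rows $\nabla F(x)$ and $x$; its points are the $[L]$ with $\nabla F(L)=\lambda L$ for some $\lambda\in\mathbb{C}$ (eigenvectors of $F$). The critical Waring variety of rank-$r$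 forms is the Zariski closure $$\mathrm{WE}_{n,r}^d=\overline{\{F\in\sigma_r^\circ(V_n^d)\mid \mathcal{W}(F)\cap\mathrm{Eig}(F)\neq\emptyset\}}\subset\mathbb{P}(\mathrm{Sym}^d(\mathbb{C}^{n+1})).$$ *)

theory Defs
  imports "HOL-Analysis.Analysis" "HOL-Library.Poly_Mapping"
begin

section \<open>Complex polynomials and forms\<close>

text \<open>
  A polynomial with variables indexed by \<open>'v\<close> is a finitely supported map from monomials
  (exponent vectors) to coefficients; addition, multiplication and powers are those of
  \<^theory>\<open>HOL-Library.Poly_Mapping\<close>. Two kinds of variables are used below: \<open>x\<^sub>0, \<dots>, x\<^sub>n\<close>
  (\<open>'v = nat\<close>), and the coordinates on \<open>\<complex>[x\<^sub>0,\<dots>,x\<^sub>n]\<^sub>d\<close>, one for each monomial of degree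
  \<open>d\<close> (\<open>'v = nat \<Rightarrow>\<^sub>0 nat\<close>).
\<close>

type_synonym 'v mpoly = "('v \<Rightarrow>\<^sub>0 nat) \<Rightarrow>\<^sub>0 complex"

abbreviation coeff_at :: "('k \<Rightarrow>\<^sub>0 'b::zero) \<Rightarrow> 'k \<Rightarrow> 'b" where
  "coeff_at \<equiv> Poly_Mapping.lookup"

definition pscale :: "complex \<Rightarrow> 'v mpoly \<Rightarrow> 'v mpoly" where
  "pscale c p = Poly_Mapping.single 0 c * p"

global_interpretation mpoly: vector_space pscale
  by unfold_locales
    (simp_all add: pscale_def algebra_simps single_add mult_single flip: mult.assoc)

definition monom_eval :: "('v \<Rightarrow> complex) \<Rightarrow> ('v \<Rightarrow>\<^sub>0 nat) \<Rightarrow> complex" where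
  "monom_eval a m = (\<Prod>v\<in>Poly_Mapping.keys m. a v ^ coeff_at m v)"

definition poly_eval :: "('v \<Rightarrow> complex) \<Rightarrow> 'v mpoly \<Rightarrow> complex" where
  "poly_eval a p = (\<Sum>m\<in>Poly_Mapping.keys p. coeff_at p m * monom_eval a m)"

text \<open>If \<open>x\<^sub>v\<close> does not occur in \<open>m\<close>, the truncated subtraction is harmless: the
  coefficient is \<open>0\<close>.\<close>

definition partial_deriv :: "'v \<Rightarrow> 'v mpoly \<Rightarrow> 'v mpoly" where
  "partial_deriv v p = (\<Sum>m\<in>Poly_Mapping.keys p.
     Poly_Mapping.single (m - Poly_Mapping.single v 1) (of_nat (coeff_at m v) * coeff_at p m))"

definition monom_degree :: "('v \<Rightarrow>\<^sub>0 nat) \<Rightarrow> nat" where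
  "monom_degree m = (\<Sum>v\<in>Poly_Mapping.keys m. coeff_at m v)"

definition monoms :: "'v set \<Rightarrow> nat \<Rightarrow> ('v \<Rightarrow>\<^sub>0 nat) set" where
  "monoms V d = {m. Poly_Mapping.keys m \<subseteq> V \<and> monom_degree m = d}"

definition homogeneous_polys :: "'v set \<Rightarrow> nat \<Rightarrow> 'v mpoly set" where
  "homogeneous_polys V d = {p. Poly_Mapping.keys p \<subseteq> monoms V d}"

text \<open>The space \<open>\<complex>[x\<^sub>0,\<dots>,x\<^sub>n]\<^sub>d\<close>, including \<open>0\<close>.\<close>

definition forms :: "nat \<Rightarrow> nat \<Rightarrow> nat mpoly set" where
  "forms n d = homogeneous_polys {..n} d"

definition coeff_vector :: "nat mpoly \<Rightarrow> nat \<Rightarrow> complex" where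
  "coeff_vector L i = coeff_at L (Poly_Mapping.single i 1)"


section \<open>Projective space and the Zariski topology\<close>

text \<open>A point of a projective space is a punctured line through the origin.\<close>

definition proj_point :: "'v mpoly \<Rightarrow> 'v mpoly set" where
  "proj_point p = {pscale c p | c. c \<noteq> 0}"

definition proj_space :: "'v mpoly set \<Rightarrow> 'v mpoly set set" where
  "proj_space W = proj_point ` (W - {0})"

definition proj_span :: "'v mpoly set set \<Rightarrow> 'v mpoly set set" where
  "proj_span P = proj_space (mpoly.span (\<Union>P))"

text \<open>Homogeneous elements of the coordinate ring of \<open>\<complex>[x\<^sub>0,\<dots>,x\<^sub>n]\<^sub>d\<close>.\<close>

definition coord_polys :: "nat \<Rightarrow> nat \<Rightarrow> (nat \<Rightarrow>\<^sub>0 nat) mpoly set" where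
  "coord_polys n d = (\<Union>e. homogeneous_polys (monoms {..n} d) e)"

definition proj_zeros ::
    "nat \<Rightarrow> nat \<Rightarrow> (nat \<Rightarrow>\<^sub>0 nat) mpoly set \<Rightarrow> nat mpoly set set" where
  "proj_zeros n d S =
     {proj_point F | F. F \<in> forms n d \<and> F \<noteq> 0 \<and> (\<forall>f\<in>S. poly_eval (coeff_at F) f = 0)}"

definition zariski :: "nat \<Rightarrow> nat \<Rightarrow> nat mpoly set topology" where
  "zariski n d = topology (\<lambda>U. \<exists>S \<subseteq> coord_polys n d. U = proj_space (forms n d) - proj_zeros n d S)"

definition irreducible_space :: "'a topology \<Rightarrow> bool" where
  "irreducible_space X \<longleftrightarrow> topspace X \<noteq> {} \<and>
     (\<forall>A B. closedin X A \<and> closedin X B \<and> topspace X = A \<union> B \<longrightarrow>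
        A = topspace X \<or> B = topspace X)"


section \<open>Waring rank, Waring locus, eigenscheme and critical Waring varieties\<close>

definition veronese :: "nat \<Rightarrow> nat \<Rightarrow> nat mpoly set set" where
  "veronese n d = {proj_point (L ^ d) | L. L \<in> forms n 1 \<and> L \<noteq> 0}"

definition sigma_open :: "nat \<Rightarrow> nat \<Rightarrow> nat \<Rightarrow> nat mpoly set set" where
  "sigma_open n d r = (\<Union>p \<in> {1..r} \<rightarrow> veronese n d. proj_span (p ` {1..r}))"

definition waring_rank :: "nat \<Rightarrow> nat \<Rightarrow> nat mpoly \<Rightarrow> nat" where
  "waring_rank n d F =
     (LEAST r. \<exists>L. (\<forall>i\<in>{1..r}. L i \<in> forms n 1) \<and> F = (\<Sum>i=1..r. L i ^ d))"

definition waring_locus :: "nat \<Rightarrow> nat \<Rightarrow> nat mpoly \<Rightarrow> nat mpoly set set" where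
  "waring_locus n d F =
     {proj_point L | L. L \<in> forms n 1 \<and> L \<noteq> 0 \<and>
        (\<exists>M. (\<forall>i\<in>{2..waring_rank n d F}. M i \<in> forms n 1) \<and>
             F \<in> mpoly.span (insert (L ^ d) ((\<lambda>i. M i ^ d) ` {2..waring_rank n d F})))}"

text \<open>The set of points of the eigenscheme, given by the \<open>2 \<times> 2\<close> minors of the matrix with rows
  \<open>\<nabla>F(x)\<close> and \<open>x\<close>; the scheme structure plays no role for the critical Waring varieties.\<close>

definition eigenpoints :: "nat \<Rightarrow> nat mpoly \<Rightarrow> nat mpoly set set" where
  "eigenpoints n F =
     {proj_point L | L. L \<in> forms n 1 \<and> L \<noteq> 0 \<and>
        (let a = coeff_vector L in
         \<forall>i\<le>n. \<forall>j\<le>n.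
           poly_eval a (partial_deriv i F) * a j - poly_eval a (partial_deriv j F) * a i = 0)}"

definition WE :: "nat \<Rightarrow> nat \<Rightarrow> nat \<Rightarrow> nat mpoly set set" where
  "WE n d r = zariski n d closure_of
     {proj_point F | F. F \<in> forms n d \<and> F \<noteq> 0 \<and> proj_point F \<in> sigma_open n d r \<and>
        waring_locus n d F \<inter> eigenpoints n F \<noteq> {}}"


section \<open>The Zariski topology is a topology\<close>

lemma monom_eval_superset:
  assumes "finite K" "Poly_Mapping.keys m \<subseteq> K"
  shows "monom_eval a m = (\<Prod>v\<in>K. a v ^ coeff_at m v)"
  unfolding monom_eval_def using assms
  by (intro prod.mono_neutral_left) (auto simp: in_keys_iff)

lemma monom_eval_add: "monom_eval a (m + m') = monom_eval a m * monom_eval a m'"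
proof -
  let ?K = "Poly_Mapping.keys m \<union> Poly_Mapping.keys m'"
  have "Poly_Mapping.keys (m + m') \<subseteq> ?K" by (rule keys_add)
  then show ?thesis
    by (simp add: monom_eval_superset[of ?K] lookup_add power_add prod.distrib)
qed

lemma monom_degree_superset:
  assumes "finite K" "Poly_Mapping.keys m \<subseteq> K"
  shows "monom_degree m = (\<Sum>v\<in>K. coeff_at m v)"
  unfolding monom_degree_def using assms
  by (intro sum.mono_neutral_left) (auto simp: in_keys_iff)

lemma monom_degree_add: "monom_degree (m + m') = monom_degree m + monom_degree m'"
proof -
  let ?K = "Poly_Mapping.keys m \<union> Poly_Mapping.keys m'"
  have "Poly_Mapping.keys (m + m') \<subseteq> ?K" by (rule keys_add)
  then show ?thesis
    by (simp add: monom_degree_superset[of ?K] lookup_add sum.distrib)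
qed

lemma poly_eval_superset:
  assumes "finite K" "Poly_Mapping.keys p \<subseteq> K"
  shows "poly_eval a p = (\<Sum>m\<in>K. coeff_at p m * monom_eval a m)"
  unfolding poly_eval_def using assms
  by (intro sum.mono_neutral_left) (auto simp: in_keys_iff)

lemma poly_eval_zero [simp]: "poly_eval a 0 = 0"
  by (simp add: poly_eval_def)

lemma poly_eval_add: "poly_eval a (p + q) = poly_eval a p + poly_eval a q"
proof -
  let ?K = "Poly_Mapping.keys p \<union> Poly_Mapping.keys q"
  have "Poly_Mapping.keys (p + q) \<subseteq> ?K" by (rule keys_add)
  then show ?thesis
    by (simp add: poly_eval_superset[of ?K] lookup_add ring_distribs sum.distrib)
qed

lemma poly_eval_sum: "poly_eval a (sum f A) = (\<Sum>x\<in>A. poly_eval a (f x))"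
  by (induction A rule: infinite_finite_induct) (simp_all add: poly_eval_add)

lemma poly_eval_single: "poly_eval a (Poly_Mapping.single m c) = c * monom_eval a m"
  by (simp add: poly_eval_def)

lemma mpoly_expansion:
  fixes p :: "'k \<Rightarrow>\<^sub>0 'b::comm_monoid_add"
  shows "p = (\<Sum>m\<in>Poly_Mapping.keys p. Poly_Mapping.single m (coeff_at p m))"
  by (rule poly_mapping_eqI) (auto simp: lookup_sum lookup_single when_def in_keys_iff)

lemma poly_eval_mult: "poly_eval a (p * q) = poly_eval a p * poly_eval a q"
proof -
  have "p * q = (\<Sum>m\<in>Poly_Mapping.keys p. Poly_Mapping.single m (coeff_at p m)) *
                (\<Sum>m\<in>Poly_Mapping.keys q. Poly_Mapping.single m (coeff_at q m))"
    by (simp flip: mpoly_expansion)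
  also have "\<dots> = (\<Sum>m\<in>Poly_Mapping.keys p. \<Sum>m'\<in>Poly_Mapping.keys q.
      Poly_Mapping.single (m + m') (coeff_at p m * coeff_at q m'))"
    by (simp add: sum_product mult_single)
  finally have "poly_eval a (p * q) =
      (\<Sum>m\<in>Poly_Mapping.keys p. \<Sum>m'\<in>Poly_Mapping.keys q.
        coeff_at p m * coeff_at q m' * monom_eval a (m + m'))"
    by (simp only: poly_eval_sum poly_eval_single)
  then show ?thesis
    by (simp add: monom_eval_add sum_product poly_eval_def[of a p] poly_eval_def[of a q]
        mult_ac)
qed

lemma homogeneous_polys_mult:
  assumes "p \<in> homogeneous_polys V d" "q \<in> homogeneous_polys V e"
  shows "p * q \<in> homogeneous_polys V (d + e)"
  unfolding homogeneous_polys_def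
proof safe
  fix m assume "m \<in> Poly_Mapping.keys (p * q)"
  then obtain a b where m: "m = a + b" and "a \<in> Poly_Mapping.keys p" "b \<in> Poly_Mapping.keys q"
    using keys_mult[of p q] by blast
  then have "a \<in> monoms V d" "b \<in> monoms V e"
    using assms by (auto simp: homogeneous_polys_def)
  then show "m \<in> monoms V (d + e)"
    using keys_add[of a b] by (auto simp: monoms_def m monom_degree_add)
qed

lemma coord_polys_mult:
  "p \<in> coord_polys n d \<Longrightarrow> q \<in> coord_polys n d \<Longrightarrow> p * q \<in> coord_polys n d"
  unfolding coord_polys_def using homogeneous_polys_mult by blast

lemma lookup_pscale: "coeff_at (pscale c p) m = c * coeff_at p m"
proof -
  have "pscale c p = Poly_Mapping.map ((*) c) p"
    by (simp add: pscale_def mult_map_scale_conv_mult)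
  then show ?thesis
    by (simp add: Poly_Mapping.map.rep_eq when_def)
qed

lemma monom_eval_scale: "monom_eval (\<lambda>v. c * a v) m = c ^ monom_degree m * monom_eval a m"
  by (simp add: monom_eval_def monom_degree_def power_mult_distrib prod.distrib power_sum)

lemma poly_eval_scale:
  assumes "f \<in> homogeneous_polys V e"
  shows "poly_eval (\<lambda>v. c * a v) f = c ^ e * poly_eval a f"
proof -
  have "monom_degree m = e" if "m \<in> Poly_Mapping.keys f" for m
    using assms that by (auto simp: homogeneous_polys_def monoms_def)
  then show ?thesis
    by (simp add: poly_eval_def monom_eval_scale sum_distrib_left algebra_simps)
qed

lemma proj_point_eqD:
  assumes "proj_point F = proj_point G"
  obtains c where "c \<noteq> 0" "F = pscale c G"
proof -
  have "F \<in> proj_point F" unfolding proj_point_def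
    by (auto intro!: exI[of _ 1])
  then show ?thesis using assms that by (auto simp: proj_point_def)
qed

lemma in_proj_zeros_iff:
  assumes "S \<subseteq> coord_polys n d" "F \<in> forms n d" "F \<noteq> 0"
  shows "proj_point F \<in> proj_zeros n d S \<longleftrightarrow> (\<forall>f\<in>S. poly_eval (coeff_at F) f = 0)"
proof
  assume "proj_point F \<in> proj_zeros n d S"
  then obtain G where G: "proj_point F = proj_point G" "\<forall>f\<in>S. poly_eval (coeff_at G) f = 0"
    by (auto simp: proj_zeros_def)
  then obtain c where "F = pscale c G" by (blast elim: proj_point_eqD)
  then have F: "coeff_at F = (\<lambda>m. c * coeff_at G m)" by (simp add: lookup_pscale fun_eq_iff)
  show "\<forall>f\<in>S. poly_eval (coeff_at F) f = 0"
  proof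
    fix f assume "f \<in> S"
    then obtain e where "f \<in> homogeneous_polys (monoms {..n} d) e"
      using assms by (auto simp: coord_polys_def)
    then show "poly_eval (coeff_at F) f = 0"
      using G \<open>f \<in> S\<close> by (simp add: F poly_eval_scale)
  qed
qed (use assms in \<open>auto simp: proj_zeros_def\<close>)

lemma proj_zeros_subset: "proj_zeros n d S \<subseteq> proj_space (forms n d)"
  by (auto simp: proj_zeros_def proj_space_def)

lemma proj_zeros_Un:
  assumes "S \<subseteq> coord_polys n d" "T \<subseteq> coord_polys n d"
  shows "proj_zeros n d S \<union> proj_zeros n d T = proj_zeros n d {f * g | f g. f \<in> S \<and> g \<in> T}"
    (is "?L = proj_zeros n d ?ST")
proof -
  have ST: "?ST \<subseteq> coord_polys n d" using assms coord_polys_mult by blast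
  have "x \<in> ?L \<longleftrightarrow> x \<in> proj_zeros n d ?ST" if x: "x \<in> proj_space (forms n d)" for x
  proof -
    obtain F where F: "x = proj_point F" "F \<in> forms n d" "F \<noteq> 0"
      using x by (auto simp: proj_space_def)
    show ?thesis
      unfolding F Un_iff in_proj_zeros_iff[OF assms(1) F(2,3)]
        in_proj_zeros_iff[OF assms(2) F(2,3)] in_proj_zeros_iff[OF ST F(2,3)]
    proof (intro iffI ballI)
      assume A: "(\<forall>f\<in>S. poly_eval (coeff_at F) f = 0) \<or> (\<forall>f\<in>T. poly_eval (coeff_at F) f = 0)"
      fix h assume "h \<in> ?ST"
      then obtain f g where "h = f * g" "f \<in> S" "g \<in> T" by blast
      with A show "poly_eval (coeff_at F) h = 0" by (auto simp: poly_eval_mult)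
    next
      assume *: "\<forall>h\<in>?ST. poly_eval (coeff_at F) h = 0"
      have "poly_eval (coeff_at F) f * poly_eval (coeff_at F) g = 0" if "f \<in> S" "g \<in> T" for f g
        using * that unfolding poly_eval_mult[symmetric] by blast
      then show "(\<forall>f\<in>S. poly_eval (coeff_at F) f = 0) \<or> (\<forall>f\<in>T. poly_eval (coeff_at F) f = 0)" by (meson mult_eq_0_iff)
    qed
  qed
  then show ?thesis using proj_zeros_subset by blast
qed

lemma proj_zeros_INT:
  assumes "\<And>S. S \<in> \<S> \<Longrightarrow> S \<subseteq> coord_polys n d"
  shows "proj_space (forms n d) \<inter> (\<Inter>S\<in>\<S>. proj_zeros n d S) = proj_zeros n d (\<Union>\<S>)"
    (is "?L = _")
proof -
  have U: "\<Union>\<S> \<subseteq> coord_polys n d" using assms by blast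
  have "x \<in> ?L \<longleftrightarrow> x \<in> proj_zeros n d (\<Union>\<S>)" if x: "x \<in> proj_space (forms n d)" for x
  proof -
    obtain F where F: "x = proj_point F" "F \<in> forms n d" "F \<noteq> 0"
      using x by (auto simp: proj_space_def)
    show ?thesis
      using x in_proj_zeros_iff[OF assms F(2,3)] in_proj_zeros_iff[OF U F(2,3)]
      by (auto simp: F(1))
  qed
  then show ?thesis using proj_zeros_subset[of n d "\<Union>\<S>"] by blast
qed

lemma istopology_zariski:
  "istopology (\<lambda>U. \<exists>S \<subseteq> coord_polys n d. U = proj_space (forms n d) - proj_zeros n d S)"
  (is "istopology ?open")
  unfolding istopology_def
proof (intro conjI allI impI)
  fix U V assume "?open U" "?open V"
  then obtain S T where ST: "S \<subseteq> coord_polys n d" "T \<subseteq> coord_polys n d"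
    and U: "U = proj_space (forms n d) - proj_zeros n d S"
    and V: "V = proj_space (forms n d) - proj_zeros n d T" by blast
  show "?open (U \<inter> V)"
  proof (intro exI conjI)
    show "{f * g | f g. f \<in> S \<and> g \<in> T} \<subseteq> coord_polys n d"
      using ST coord_polys_mult by blast
    show "U \<inter> V = proj_space (forms n d) - proj_zeros n d {f * g | f g. f \<in> S \<and> g \<in> T}"
      unfolding U V proj_zeros_Un[OF ST, symmetric] by blast
  qed
next
  fix \<U> assume "\<forall>U\<in>\<U>. ?open U"
  then obtain S where S: "\<And>U. U \<in> \<U> \<Longrightarrow> S U \<subseteq> coord_polys n d"
    "\<And>U. U \<in> \<U> \<Longrightarrow> U = proj_space (forms n d) - proj_zeros n d (S U)" by metis
  show "?open (\<Union>\<U>)"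
  proof (intro exI conjI)
    show "\<Union>(S ` \<U>) \<subseteq> coord_polys n d" using S by blast
    have "proj_space (forms n d) \<inter> (\<Inter>T\<in>S ` \<U>. proj_zeros n d T) = proj_zeros n d (\<Union>(S ` \<U>))"
      using S by (intro proj_zeros_INT) blast
    then show "\<Union>\<U> = proj_space (forms n d) - proj_zeros n d (\<Union>(S ` \<U>))"
      using S(2) by blast
  qed
qed

lemma openin_zariski:
  "openin (zariski n d) U \<longleftrightarrow>
     (\<exists>S \<subseteq> coord_polys n d. U = proj_space (forms n d) - proj_zeros n d S)"
  unfolding zariski_def by (simp add: istopology_zariski)

lemma topspace_zariski [simp]: "topspace (zariski n d) = proj_space (forms n d)"
proof (rule antisym)
  show "topspace (zariski n d) \<subseteq> proj_space (forms n d)"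
    by (auto simp: topspace_def openin_zariski)
  have "(1 :: (nat \<Rightarrow>\<^sub>0 nat) mpoly) \<in> coord_polys n d"
    by (auto simp: coord_polys_def homogeneous_polys_def monoms_def monom_degree_def)
  moreover have "proj_zeros n d {1} = {}"
    by (simp add: proj_zeros_def poly_eval_def monom_eval_def)
  ultimately have "openin (zariski n d) (proj_space (forms n d))"
    unfolding openin_zariski by (intro exI[of _ "{1}"]) auto
  then show "proj_space (forms n d) \<subseteq> topspace (zariski n d)"
    by (rule openin_subset)
qed

lemma closedin_zariski:
  "closedin (zariski n d) C \<longleftrightarrow> (\<exists>S \<subseteq> coord_polys n d. C = proj_zeros n d S)"
proof -
  have "C \<subseteq> P \<and> P - C = P - Z \<longleftrightarrow> C = Z" if "Z \<subseteq> P" for P Z :: "nat mpoly set set"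
    using that by blast
  then show ?thesis
    unfolding closedin_def openin_zariski topspace_zariski
    using proj_zeros_subset by metis
qed


section \<open>Eigenpoints are the eigenvectors\<close>

lemma coeff_vector_nonzero:
  assumes "L \<in> forms n 1" "L \<noteq> 0"
  obtains i where "i \<le> n" "coeff_vector L i \<noteq> 0"
proof -
  obtain m where m: "m \<in> Poly_Mapping.keys L"
    using assms(2) by (metis in_keys_iff lookup_zero poly_mapping_eqI)
  then have deg: "Poly_Mapping.keys m \<subseteq> {..n}" "(\<Sum>v\<in>Poly_Mapping.keys m. coeff_at m v) = 1"
    using assms(1)
    by (auto simp: forms_def homogeneous_polys_def monoms_def monom_degree_def)
  then obtain i where i: "i \<in> Poly_Mapping.keys m" "coeff_at m i = 1"
    "\<And>j. j \<in> Poly_Mapping.keys m \<Longrightarrow> j \<noteq> i \<Longrightarrow> coeff_at m j = 0"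
    using sum_eq_1_iff[OF finite_keys, of "coeff_at m" m] by metis
  have "m = Poly_Mapping.single i 1"
    by (rule poly_mapping_eqI) (metis i(2,3) in_keys_iff lookup_single_eq lookup_single_not_eq)
  then show ?thesis
    using that[of i] i(1) deg(1) m by (auto simp: coeff_vector_def in_keys_iff)
qed

lemma minors_zero_iff:
  fixes g a :: "nat \<Rightarrow> complex"
  assumes k: "k \<le> n" "a k \<noteq> 0"
  shows "(\<forall>i\<le>n. \<forall>j\<le>n. g i * a j - g j * a i = 0) \<longleftrightarrow> (\<exists>\<mu>. \<forall>i\<le>n. g i = \<mu> * a i)"
proof
  assume *: "\<forall>i\<le>n. \<forall>j\<le>n. g i * a j - g j * a i = 0"
  have "g i = g k / a k * a i" if "i \<le> n" for i
  proof -
    have "g i * a k - g k * a i = 0" using * that k by blast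
    then show ?thesis using k by (simp add: field_simps)
  qed
  then show "\<exists>\<mu>. \<forall>i\<le>n. g i = \<mu> * a i" by blast
qed auto

lemma eigenpoints_eq:
  "eigenpoints n F =
     {proj_point L | L. L \<in> forms n 1 \<and> L \<noteq> 0 \<and>
        (\<exists>\<mu>. \<forall>i\<le>n. poly_eval (coeff_vector L) (partial_deriv i F) = \<mu> * coeff_vector L i)}"
  unfolding eigenpoints_def Let_def
proof (intro Collect_cong ex_cong1 conj_cong refl)
  fix L assume "L \<in> forms n 1" "L \<noteq> 0"
  then obtain k where "k \<le> n" "coeff_vector L k \<noteq> 0" by (rule coeff_vector_nonzero)
  then show "(\<forall>i\<le>n. \<forall>j\<le>n. poly_eval (coeff_vector L) (partial_deriv i F) * coeff_vector L j
        - poly_eval (coeff_vector L) (partial_deriv j F) * coeff_vector L i = 0) \<longleftrightarrow>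
      (\<exists>\<mu>. \<forall>i\<le>n. poly_eval (coeff_vector L) (partial_deriv i F) = \<mu> * coeff_vector L i)"
    by (rule minors_zero_iff)
qed

end

theory Submission
  imports Defs
begin

text \<open>
  Write a binary form of rank at most \<open>r\<close> as \<open>F = \<Sum>\<^sub>i c\<^sub>i L\<^sub>i\<^sup>d\<close> with \<open>L\<^sub>i = a\<^sub>i x\<^sub>0 + b\<^sub>i x\<^sub>1\<close>. By the
  chain rule, \<open>L\<^sub>1\<close> is an eigenvector of \<open>F\<close> if and only if \<open>\<Sum>\<^sub>i c\<^sub>i q\<^sub>i = 0\<close>, where
  \<open>q\<^sub>i = \<langle>L\<^sub>1, L\<^sub>i\<rangle>\<^bsup>d-1\<^esup> det(L\<^sub>i, L\<^sub>1)\<close> (\<open>eigen_minor\<close>). Every point of the critical locus has such a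
  representation (\<open>critical_points_power_sumE\<close>). Conversely, if all \<open>c\<^sub>i\<close> are nonzero and the \<open>L\<^sub>i\<close>
  are pairwise independent, then \<open>2r \<le> d + 1\<close> forces the rank of \<open>F\<close> to be exactly \<open>r\<close>, because
  powers of at most \<open>d + 1\<close> pairwise independent linear forms are linearly independent; hence \<open>L\<^sub>1\<close>
  is in the Waring locus and \<open>F\<close> is critical (\<open>power_sum_in_critical_points\<close>).

  It remains to parametrize the solutions of \<open>\<Sum>\<^sub>i c\<^sub>i q\<^sub>i = 0\<close> by polynomials in free parameters.
  For \<open>r = 1\<close> there is no condition, for \<open>r = 2\<close> the second linear form may be taken orthogonal to the
  first, and for \<open>r \<ge> 3\<close> the equation, which is linear in the \<open>c\<^sub>i\<close>, is solved for \<open>c\<^sub>2\<close>. The solutions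
  with \<open>q\<^sub>2 = 0\<close> are not lost: some other \<open>q\<^sub>i\<close> is nonzero, or \<open>F\<close> is a combination of just two powers
  and a linear form of weight \<open>0\<close> can be inserted (\<open>power_sum_second_minor_nonzero\<close>). In each case
  the whole locus is covered and generic parameters give critical points, so the closure is
  irreducible (\<open>irreducible_closure_of_parametrized\<close>).
\<close>


section \<open>Binary linear forms and their powers\<close>

definition linear_form :: "complex \<Rightarrow> complex \<Rightarrow> nat mpoly" where
  "linear_form a b =
     Poly_Mapping.single (Poly_Mapping.single 0 1) a + Poly_Mapping.single (Poly_Mapping.single 1 1) b"

definition binary_monom :: "nat \<Rightarrow> nat \<Rightarrow> nat \<Rightarrow>\<^sub>0 nat" where
  "binary_monom k l = Poly_Mapping.single 0 k + Poly_Mapping.single 1 l"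

lemma lookup_binary_monom: "coeff_at (binary_monom k l) i = (if i = 0 then k else if i = 1 then l else 0)"
  by (auto simp: binary_monom_def lookup_add lookup_single when_def)

lemma binary_monom_in_monoms: "binary_monom k l \<in> monoms {..1} (k + l)"
proof -
  have "Poly_Mapping.keys (binary_monom k l) \<subseteq> {..1}"
    by (auto simp: in_keys_iff lookup_binary_monom split: if_splits)
  then show ?thesis
    by (auto simp: monoms_def monom_degree_superset[of "{..1}"] lookup_binary_monom atMost_Suc)
qed

lemma monoms_binary_eq:
  assumes "m \<in> monoms {..1} d"
  shows "coeff_at m 0 \<le> d" "m = binary_monom (coeff_at m 0) (d - coeff_at m 0)"
proof -
  have k: "Poly_Mapping.keys m \<subseteq> {..1}" and d: "monom_degree m = d"
    using assms by (auto simp: monoms_def)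
  then have *: "coeff_at m 0 + coeff_at m 1 = d"
    by (simp add: monom_degree_superset[of "{..1}"] atMost_Suc)
  then show "coeff_at m 0 \<le> d" by simp
  have "coeff_at m i = 0" if "i \<noteq> 0" "i \<noteq> 1" for i
  proof -
    have "i \<notin> {..1}" using that by auto
    then show ?thesis using k by (meson in_keys_iff subsetD)
  qed
  then show "m = binary_monom (coeff_at m 0) (d - coeff_at m 0)"
    using * by (intro poly_mapping_eqI) (auto simp: lookup_binary_monom)
qed

lemma finite_binary_monoms: "finite (monoms {..1::nat} d)"
proof (rule finite_subset)
  show "monoms {..1} d \<subseteq> (\<lambda>k. binary_monom k (d - k)) ` {..d}"
    using monoms_binary_eq by blast
qed simp

lemma binary_monom_eq_iff: "binary_monom k l = binary_monom k' l' \<longleftrightarrow> k = k' \<and> l = l'"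
proof
  assume eq: "binary_monom k l = binary_monom k' l'"
  have "coeff_at (binary_monom k l) i = coeff_at (binary_monom k' l') i" for i by (simp add: eq)
  from this[of 0] this[of 1] show "k = k' \<and> l = l'" by (simp add: lookup_binary_monom)
qed simp

lemma linear_form_in_forms: "linear_form a b \<in> forms 1 1"
proof -
  have "linear_form a b = Poly_Mapping.single (binary_monom 1 0) a + Poly_Mapping.single (binary_monom 0 1) b"
    by (simp add: linear_form_def binary_monom_def)
  then have "Poly_Mapping.keys (linear_form a b) \<subseteq> {binary_monom 1 0, binary_monom 0 1}"
    using keys_add by (fastforce split: if_splits)
  then show ?thesis
    using binary_monom_in_monoms[of 1 0] binary_monom_in_monoms[of 0 1]
    by (auto simp: forms_def homogeneous_polys_def)
qed

lemma coeff_vector_linear_form: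
  "coeff_vector (linear_form a b) 0 = a" "coeff_vector (linear_form a b) 1 = b"
  by (auto simp: coeff_vector_def linear_form_def lookup_add lookup_single when_def
      dest: arg_cong[where f="\<lambda>m. coeff_at m 0"])

lemma linear_form_eq_iff: "linear_form a b = linear_form a' b' \<longleftrightarrow> a = a' \<and> b = b'"
  by (metis coeff_vector_linear_form)

lemma linear_form_0: "linear_form 0 0 = 0"
  by (simp add: linear_form_def)

lemma linear_form_eq_0_iff: "linear_form a b = 0 \<longleftrightarrow> a = 0 \<and> b = 0"
  by (metis linear_form_0 linear_form_eq_iff)

lemma forms_1_1E:
  assumes "L \<in> forms 1 1"
  obtains a b where "L = linear_form a b"
proof
  show "L = linear_form (coeff_vector L 0) (coeff_vector L 1)"
  proof (rule poly_mapping_eqI)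
    fix m
    have B: "linear_form a b = Poly_Mapping.single (binary_monom 1 0) a + Poly_Mapping.single (binary_monom 0 1) b" for a b
      by (simp add: linear_form_def binary_monom_def)
    have C: "coeff_vector L 0 = coeff_at L (binary_monom 1 0)" "coeff_vector L 1 = coeff_at L (binary_monom 0 1)"
      by (simp_all add: coeff_vector_def binary_monom_def)
    show "coeff_at L m = coeff_at (linear_form (coeff_vector L 0) (coeff_vector L 1)) m"
    proof (cases "m \<in> monoms {..1} 1")
      case True
      then have "m = binary_monom 1 0 \<or> m = binary_monom 0 1"
        using monoms_binary_eq[OF True] by (cases "coeff_at m 0") auto
      then show ?thesis
        by (auto simp: B C[unfolded One_nat_def] lookup_add lookup_single when_def binary_monom_eq_iff)
    next
      case False
      then have "m \<noteq> binary_monom 1 0" "m \<noteq> binary_monom 0 1"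
        using binary_monom_in_monoms[of 1 0] binary_monom_in_monoms[of 0 1] by auto
      moreover have "coeff_at L m = 0"
        using False assms by (auto simp: forms_def homogeneous_polys_def in_keys_iff)
      ultimately show ?thesis
        by (simp add: B lookup_add lookup_single when_def)
    qed
  qed
qed

lemma pscale_linear_form: "pscale c (linear_form a b) = linear_form (c * a) (c * b)"
  by (rule poly_mapping_eqI) (simp add: lookup_pscale linear_form_def lookup_add lookup_single when_def distrib_left)

lemma pscale_power: "pscale c p ^ n = pscale (c ^ n) (p ^ n)"
proof (induction n)
  case 0
  then show ?case by simp
next
  case (Suc n)
  have "pscale c p * pscale x q = pscale (c * x) (p * q)" for x q
    by (simp add: pscale_def mult_single flip: mult.assoc) (simp add: mult_ac mult_single)
  then show ?case by (simp add: Suc)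
qed

lemma poly_eval_pscale: "poly_eval x (pscale c p) = c * poly_eval x p"
  by (simp add: pscale_def poly_eval_mult poly_eval_single monom_eval_def)

lemma poly_eval_one: "poly_eval x 1 = 1"
  by (simp add: poly_eval_def monom_eval_def)

lemma poly_eval_power: "poly_eval x (p ^ n) = poly_eval x p ^ n"
  by (induction n) (simp_all add: poly_eval_mult poly_eval_one)

lemma poly_eval_prod: "poly_eval x (prod f I) = (\<Prod>i\<in>I. poly_eval x (f i))"
  by (induction I rule: infinite_finite_induct) (simp_all add: poly_eval_mult poly_eval_one)

lemma monom_eval_single: "monom_eval x (Poly_Mapping.single v k) = x v ^ k"
  by (subst monom_eval_superset[of "{v}"]) auto

lemma poly_eval_linear_form: "poly_eval x (linear_form a b) = a * x 0 + b * x 1"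
  by (simp add: linear_form_def poly_eval_add poly_eval_single monom_eval_single)

lemma monom_eval_binary_monom: "monom_eval x (binary_monom k l) = x 0 ^ k * x 1 ^ l"
  by (simp add: binary_monom_def monom_eval_add monom_eval_single)

lemma power_linear_form:
  "linear_form a b ^ d =
     (\<Sum>k\<le>d. Poly_Mapping.single (binary_monom k (d - k)) (of_nat (d choose k) * a ^ k * b ^ (d - k)))"
proof -
  have single_pow: "Poly_Mapping.single (Poly_Mapping.single v 1) c ^ k =
      Poly_Mapping.single (Poly_Mapping.single v k) (c ^ k)" for v :: nat and c :: complex and k
    by (induction k) (simp_all add: mult_single flip: single_add)
  have of_nat: "of_nat k * Poly_Mapping.single m c = Poly_Mapping.single m (of_nat k * c)"
    for k and m :: "nat \<Rightarrow>\<^sub>0 nat" and c :: complex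
    by (induction k) (simp_all add: ring_distribs single_add)
  show ?thesis
    unfolding linear_form_def binomial_ring single_pow
    by (simp add: mult_single mult.assoc of_nat binary_monom_def)
qed

text \<open>The assignment \<open>case_nat a (\<lambda>_. b)\<close> is the point \<open>(a, b)\<close>: only \<open>x\<^sub>0\<close> and \<open>x\<^sub>1\<close> occur in the
  monomials it is applied to.\<close>

lemma lookup_power_linear_form:
  "coeff_at (linear_form a b ^ d) m =
     (if m \<in> monoms {..1} d
      then of_nat (d choose coeff_at m 0) * monom_eval (case_nat a (\<lambda>_. b)) m else 0)"
proof (cases "m \<in> monoms {..1} d")
  case True
  define k where "k = coeff_at m 0"
  have k: "k \<le> d" and m: "m = binary_monom k (d - k)"
    using monoms_binary_eq[OF True] by (simp_all add: k_def)
  have "coeff_at (linear_form a b ^ d) m =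
      (\<Sum>j\<le>d. if j = k then of_nat (d choose k) * a ^ k * b ^ (d - k) else 0)"
    unfolding power_linear_form lookup_sum
    by (intro sum.cong) (auto simp: m lookup_single when_def binary_monom_eq_iff)
  also have "\<dots> = of_nat (d choose k) * a ^ k * b ^ (d - k)" using k by simp
  finally show ?thesis
    using True by (simp add: k_def[symmetric] monom_eval_binary_monom m lookup_binary_monom)
next
  case False
  then have *: "binary_monom k (d - k) \<noteq> m" if "k \<le> d" for k
    using binary_monom_in_monoms[of k "d - k"] that by auto
  have "coeff_at (linear_form a b ^ d) m = 0"
    unfolding power_linear_form lookup_sum by (intro sum.neutral) (simp add: lookup_single when_def *)
  then show ?thesis using False by simp
qed

lemma forms_add: "F \<in> forms n d \<Longrightarrow> G \<in> forms n d \<Longrightarrow> F + G \<in> forms n d"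
  using keys_add[of F G] by (auto simp: forms_def homogeneous_polys_def)

lemma forms_sum: "(\<And>i. i \<in> I \<Longrightarrow> f i \<in> forms n d) \<Longrightarrow> sum f I \<in> forms n d"
proof (induction I rule: infinite_finite_induct)
  case (insert x I)
  then show ?case by (auto intro!: forms_add)
qed (auto simp: forms_def homogeneous_polys_def)

lemma forms_pscale: "F \<in> forms n d \<Longrightarrow> pscale c F \<in> forms n d"
  by (auto simp: forms_def homogeneous_polys_def in_keys_iff lookup_pscale)

lemma forms_mult: "F \<in> forms n d \<Longrightarrow> G \<in> forms n e \<Longrightarrow> F * G \<in> forms n (d + e)"
  unfolding forms_def by (rule homogeneous_polys_mult)

lemma forms_one: "1 \<in> forms n 0"
  by (auto simp: forms_def homogeneous_polys_def monoms_def monom_degree_def)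

lemma forms_power: "F \<in> forms n 1 \<Longrightarrow> F ^ k \<in> forms n k"
  by (induction k) (use forms_one forms_mult[of F n 1] in auto)

lemma forms_prod: "(\<And>i. i \<in> I \<Longrightarrow> f i \<in> forms n 1) \<Longrightarrow> prod f I \<in> forms n (card I)"
proof (induction I rule: infinite_finite_induct)
  case (insert x I)
  then show ?case using forms_mult[of "f x" n 1 "prod f I"] by auto
qed (auto simp: forms_one)


section \<open>Apolarity and the Waring rank\<close>

text \<open>The apolar pairing (up to a factor \<open>d!\<close>). Its reproducing property
  \<open>\<langle>G, (a x\<^sub>0 + b x\<^sub>1)\<^sup>d\<rangle> = G(a, b)\<close> turns a linear relation between powers of linear forms into
  a relation between values of an arbitrary form \<open>G\<close>, which may be chosen to vanish at all but one
  of the points concerned.\<close>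

definition apolar :: "nat \<Rightarrow> nat mpoly \<Rightarrow> nat mpoly \<Rightarrow> complex" where
  "apolar d G F =
     (\<Sum>m\<in>monoms {..1} d. coeff_at G m * coeff_at F m / of_nat (d choose coeff_at m 0))"

lemma apolar_sum_pscale: "apolar d G (\<Sum>i\<in>I. pscale (c i) (F i)) = (\<Sum>i\<in>I. c i * apolar d G (F i))"
  unfolding apolar_def lookup_sum lookup_pscale sum_distrib_left sum_divide_distrib
  by (subst sum.swap) (simp add: mult_ac)

lemma apolar_power_linear_form:
  assumes "G \<in> forms 1 d"
  shows "apolar d G (linear_form a b ^ d) = poly_eval (case_nat a (\<lambda>_. b)) G"
proof -
  have "d choose coeff_at m 0 \<noteq> 0" if "m \<in> monoms {..1} d" for m :: "nat \<Rightarrow>\<^sub>0 nat"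
    using monoms_binary_eq(1)[OF that] by simp
  then have "apolar d G (linear_form a b ^ d) =
      (\<Sum>m\<in>monoms {..1} d. coeff_at G m * monom_eval (case_nat a (\<lambda>_. b)) m)"
    unfolding apolar_def by (intro sum.cong) (auto simp: lookup_power_linear_form)
  also have "\<dots> = poly_eval (case_nat a (\<lambda>_. b)) G"
    using assms finite_binary_monoms
    by (subst poly_eval_superset[of "monoms {..1} d"]) (auto simp: forms_def homogeneous_polys_def)
  finally show ?thesis .
qed

definition power_sum :: "nat \<Rightarrow> nat \<Rightarrow> (nat \<Rightarrow> complex) \<Rightarrow> (nat \<Rightarrow> complex) \<Rightarrow> (nat \<Rightarrow> complex) \<Rightarrow> nat mpoly" where
  "power_sum d r c a b = (\<Sum>i=1..r. pscale (c i) (linear_form (a i) (b i) ^ d))"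

lemma power_sum_in_forms: "power_sum d r c a b \<in> forms 1 d"
  unfolding power_sum_def by (intro forms_sum forms_pscale forms_power linear_form_in_forms)

lemma apolar_power_sum:
  assumes "G \<in> forms 1 d"
  shows "apolar d G (power_sum d r c a b) = (\<Sum>i=1..r. c i * poly_eval (case_nat (a i) (\<lambda>_. b i)) G)"
  unfolding power_sum_def apolar_sum_pscale apolar_power_linear_form[OF assms] ..

text \<open>With fewer than \<open>r\<close> powers on the right, some \<open>[a\<^sub>p : b\<^sub>p]\<close> is none of the points of that
  side. The at most \<open>2r - 2 < d\<close> other points lie on a form of degree \<open>d\<close> that does not vanish
  there, and pairing with this form isolates \<open>c\<^sub>p\<close>.\<close>

lemma power_sum_length_minimal:
  assumes d: "2 * r \<le> d + 1"
    and c: "\<And>i. i \<in> {1..r} \<Longrightarrow> c i \<noteq> 0"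
    and nz: "\<And>i. i \<in> {1..r} \<Longrightarrow> (a i, b i) \<noteq> (0, 0)"
    and indep: "\<And>i j. i \<in> {1..r} \<Longrightarrow> j \<in> {1..r} \<Longrightarrow> i \<noteq> j \<Longrightarrow> a i * b j - a j * b i \<noteq> 0"
    and eq: "power_sum d r c a b = power_sum d s e u v"
  shows "r \<le> s"
proof (rule ccontr)
  assume "\<not> r \<le> s"
  then have sr: "s < r" by simp
  have "\<exists>p\<in>{1..r}. \<forall>j\<in>{1..s}. (u j, v j) = (0, 0) \<or> a p * v j - u j * b p \<noteq> 0"
  proof (rule ccontr)
    assume "\<not> ?thesis"
    then obtain f where f: "\<And>i. i \<in> {1..r} \<Longrightarrow> f i \<in> {1..s} \<and> (u (f i), v (f i)) \<noteq> (0, 0) \<and> a i * v (f i) - u (f i) * b i = 0"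
      by metis
    have "inj_on f {1..r}"
    proof (rule inj_onI, rule ccontr)
      fix i j assume ij: "i \<in> {1..r}" "j \<in> {1..r}" "f i = f j" "i \<noteq> j"
      let ?u = "u (f i)" and ?v = "v (f i)"
      have "a i * ?v = ?u * b i" "a j * ?v = ?u * b j" "(?u, ?v) \<noteq> (0, 0)"
        using f[OF ij(1)] f[OF ij(2)] ij(3) by auto
      then have "?u * (a i * b j - a j * b i) = 0" "?v * (a i * b j - a j * b i) = 0"
        by algebra+
      then show False using indep[OF ij(1,2,4)] \<open>(?u, ?v) \<noteq> (0, 0)\<close> by auto
    qed
    then have "card {1..r} \<le> card {1..s}"
      using f by (intro card_inj_on_le[of f]) auto
    then show False using sr by simp
  qed
  then obtain p where p: "p \<in> {1..r}"
    and sep: "\<And>j. j \<in> {1..s} \<Longrightarrow> (u j, v j) = (0, 0) \<or> a p * v j - u j * b p \<noteq> 0" by blast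
  \<comment> \<open>The vector \<open>w\<close> supplies filler factors: they raise the degree of \<open>G\<close> to \<open>d\<close> and replace the
    factors of linear forms that are \<open>0\<close>.\<close>
  define w :: "complex \<times> complex" where "w = (if b p = 0 then (0, 1) else (1, 0))"
  have w: "a p * snd w - fst w * b p \<noteq> 0" using nz[OF p] by (auto simp: w_def)
  define w' where "w' j = (if (u j, v j) = (0, 0) then w else (u j, v j))" for j
  define n where "n = d - (r - 1) - s"
  have n: "n > 0" "(r - 1) + s + n = d" using d sr by (auto simp: n_def)
  define G where "G = (\<Prod>i\<in>{1..r} - {p}. linear_form (b i) (- a i)) *
     (\<Prod>j\<in>{1..s}. linear_form (snd (w' j)) (- fst (w' j))) * linear_form (snd w) (- fst w) ^ n"
  have "G \<in> forms 1 (card ({1..r} - {p}) + card {1..s} + n)"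
    unfolding G_def by (intro forms_mult forms_prod forms_power linear_form_in_forms)
  then have G: "G \<in> forms 1 d" using n p by simp
  have eval: "poly_eval (case_nat x (\<lambda>_. y)) G =
     (\<Prod>i\<in>{1..r} - {p}. b i * x - a i * y) *
     (\<Prod>j\<in>{1..s}. snd (w' j) * x - fst (w' j) * y) * (snd w * x - fst w * y) ^ n" for x y
    by (simp add: G_def poly_eval_mult poly_eval_prod poly_eval_power poly_eval_linear_form)
  have 1: "poly_eval (case_nat (a i) (\<lambda>_. b i)) G = 0" if "i \<in> {1..r}" "i \<noteq> p" for i
    unfolding eval using that by (auto intro!: prod_zero bexI[of _ i])
  have 2: "poly_eval (case_nat (u j) (\<lambda>_. v j)) G = 0" if j: "j \<in> {1..s}" for j
  proof (cases "(u j, v j) = (0, 0)")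
    case True
    then show ?thesis using n by (simp add: eval)
  next
    case False
    then show ?thesis unfolding eval using j by (auto intro!: prod_zero bexI[of _ j] simp: w'_def)
  qed
  have 3: "poly_eval (case_nat (a p) (\<lambda>_. b p)) G \<noteq> 0"
  proof -
    have "b i * a p - a i * b p \<noteq> 0" if "i \<in> {1..r} - {p}" for i
      using indep[OF p, of i] that by (auto simp: mult_ac)
    moreover have "snd (w' j) * a p - fst (w' j) * b p \<noteq> 0" if "j \<in> {1..s}" for j
      using sep[OF that] w by (auto simp: w'_def mult_ac)
    moreover have "snd w * a p - fst w * b p \<noteq> 0" using w by (simp add: mult_ac)
    ultimately show ?thesis by (simp add: eval)
  qed
  have "(\<Sum>i=1..r. c i * poly_eval (case_nat (a i) (\<lambda>_. b i)) G) =
        (\<Sum>j=1..s. e j * poly_eval (case_nat (u j) (\<lambda>_. v j)) G)"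
    using eq apolar_power_sum[OF G] by metis
  also have "\<dots> = 0" using 2 by (intro sum.neutral) auto
  also have "(\<Sum>i=1..r. c i * poly_eval (case_nat (a i) (\<lambda>_. b i)) G) =
      (\<Sum>i=1..r. if i = p then c p * poly_eval (case_nat (a p) (\<lambda>_. b p)) G else 0)"
    using 1 by (intro sum.cong) auto
  also have "\<dots> = c p * poly_eval (case_nat (a p) (\<lambda>_. b p)) G" using p by simp
  finally show False using c[OF p] 3 by simp
qed


section \<open>Critical points as constrained power sums\<close>

lemma monom_eval_has_derivative:
  "((\<lambda>z. monom_eval (x(v := z)) m) has_field_derivative
      of_nat (coeff_at m v) * monom_eval x (m - Poly_Mapping.single v 1)) (at (x v))"
proof -
  let ?R = "\<Prod>u\<in>Poly_Mapping.keys m - {v}. x u ^ coeff_at m u"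
  have split: "monom_eval y m' = y v ^ coeff_at m' v * ?R"
    if "Poly_Mapping.keys m' \<subseteq> Poly_Mapping.keys m"
      "\<And>u. u \<noteq> v \<Longrightarrow> y u = x u \<and> coeff_at m' u = coeff_at m u" for y m'
  proof -
    have "monom_eval y m' = (\<Prod>u\<in>insert v (Poly_Mapping.keys m). y u ^ coeff_at m' u)"
      using that(1) by (intro monom_eval_superset) auto
    also have "\<dots> = y v ^ coeff_at m' v * (\<Prod>u\<in>Poly_Mapping.keys m - {v}. y u ^ coeff_at m' u)"
      by (subst prod.insert_remove) simp_all
    also have "(\<Prod>u\<in>Poly_Mapping.keys m - {v}. y u ^ coeff_at m' u) = ?R"
      using that(2) by (intro prod.cong) auto
    finally show ?thesis .
  qed
  have "(\<lambda>z. monom_eval (x(v := z)) m) = (\<lambda>z. z ^ coeff_at m v * ?R)"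
    by (rule ext) (subst split, simp_all)
  moreover have "monom_eval x (m - Poly_Mapping.single v 1) = x v ^ (coeff_at m v - 1) * ?R"
    by (subst split) (auto simp: lookup_minus lookup_single when_def in_keys_iff)
  ultimately show ?thesis
    by (auto intro!: derivative_eq_intros)
qed

text \<open>Identifying the formal partial derivatives with analytic ones lets the chain rule
  differentiate powers of linear forms.\<close>

lemma poly_eval_has_derivative:
  "((\<lambda>z. poly_eval (x(v := z)) p) has_field_derivative poly_eval x (partial_deriv v p)) (at (x v))"
proof -
  have *: "poly_eval x (partial_deriv v p) = (\<Sum>m\<in>Poly_Mapping.keys p.
      coeff_at p m * (of_nat (coeff_at m v) * monom_eval x (m - Poly_Mapping.single v 1)))"
    by (simp add: partial_deriv_def poly_eval_sum poly_eval_single mult_ac)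
  show ?thesis
    unfolding * unfolding poly_eval_def
    by (intro DERIV_sum DERIV_cmult monom_eval_has_derivative)
qed

lemma poly_eval_power_sum:
  "poly_eval x (power_sum d r c a b) = (\<Sum>i=1..r. c i * (a i * x 0 + b i * x 1) ^ d)"
  by (simp add: power_sum_def poly_eval_sum poly_eval_pscale poly_eval_power poly_eval_linear_form)

lemma partial_deriv_power_sum:
  shows "poly_eval x (partial_deriv 0 (power_sum d r c a b)) =
      (\<Sum>i=1..r. c i * (of_nat d * (a i * x 0 + b i * x 1) ^ (d - 1) * a i))"
    and "poly_eval x (partial_deriv 1 (power_sum d r c a b)) =
      (\<Sum>i=1..r. c i * (of_nat d * (a i * x 0 + b i * x 1) ^ (d - 1) * b i))"
proof -
  have pow: "((\<lambda>z. (\<alpha> * z + \<beta>) ^ d) has_field_derivative of_nat d * (\<alpha> * w + \<beta>) ^ (d - 1) * \<alpha>) (at w)"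
    for \<alpha> \<beta> w :: complex
    by (rule derivative_eq_intros refl | simp)+
  have "((\<lambda>z. poly_eval (x(0 := z)) (power_sum d r c a b)) has_field_derivative
      (\<Sum>i=1..r. c i * (of_nat d * (a i * x 0 + b i * x 1) ^ (d - 1) * a i))) (at (x 0))"
    unfolding poly_eval_power_sum
    using pow[of "a _" "b _ * x 1" "x 0"] by (intro DERIV_sum DERIV_cmult) simp
  then show "poly_eval x (partial_deriv 0 (power_sum d r c a b)) =
      (\<Sum>i=1..r. c i * (of_nat d * (a i * x 0 + b i * x 1) ^ (d - 1) * a i))"
    by (rule DERIV_unique[OF poly_eval_has_derivative])
  have "((\<lambda>z. poly_eval (x(1 := z)) (power_sum d r c a b)) has_field_derivative
      (\<Sum>i=1..r. c i * (of_nat d * (a i * x 0 + b i * x 1) ^ (d - 1) * b i))) (at (x 1))"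
    unfolding poly_eval_power_sum
    using pow[of "b _" "a _ * x 0" "x 1"]
    by (intro DERIV_sum DERIV_cmult) (simp add: add.commute)
  then show "poly_eval x (partial_deriv 1 (power_sum d r c a b)) =
      (\<Sum>i=1..r. c i * (of_nat d * (a i * x 0 + b i * x 1) ^ (d - 1) * b i))"
    by (rule DERIV_unique[OF poly_eval_has_derivative])
qed

(* Indices start at 1, which is to be kept apart from the successor form. *)
declare One_nat_def [simp del]

text \<open>The contribution of the power \<open>(u x\<^sub>0 + v x\<^sub>1)\<^sup>d\<close> to the minor of the eigenscheme at the
  point \<open>(a, b)\<close>, divided by \<open>d\<close>.\<close>

definition eigen_minor :: "nat \<Rightarrow> complex \<Rightarrow> complex \<Rightarrow> complex \<Rightarrow> complex \<Rightarrow> complex" where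
  "eigen_minor d a b u v = (a * u + b * v) ^ (d - 1) * (u * b - v * a)"

lemma eigen_minor_self [simp]: "eigen_minor d a b a b = 0"
  by (simp add: eigen_minor_def)

definition first_is_eigenvector ::
    "nat \<Rightarrow> nat \<Rightarrow> (nat \<Rightarrow> complex) \<Rightarrow> (nat \<Rightarrow> complex) \<Rightarrow> (nat \<Rightarrow> complex) \<Rightarrow> bool" where
  "first_is_eigenvector d r c a b \<longleftrightarrow> (\<Sum>i=1..r. c i * eigen_minor d (a 1) (b 1) (a i) (b i)) = 0"

lemma eigen_minors_power_sum:
  fixes \<alpha> \<beta> :: complex and c a b :: "nat \<Rightarrow> complex" and d r :: nat
  assumes "d \<noteq> 0"
  defines "x \<equiv> coeff_vector (linear_form \<alpha> \<beta>)" and "F \<equiv> power_sum d r c a b"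
  shows "(\<forall>i\<le>1. \<forall>j\<le>1. poly_eval x (partial_deriv i F) * x j - poly_eval x (partial_deriv j F) * x i = 0)
    \<longleftrightarrow> (\<Sum>i=1..r. c i * eigen_minor d \<alpha> \<beta> (a i) (b i)) = 0"
proof -
  have x: "x 0 = \<alpha>" "x 1 = \<beta>" by (simp_all add: x_def coeff_vector_linear_form)
  have "poly_eval x (partial_deriv 0 F) * x 1 - poly_eval x (partial_deriv 1 F) * x 0 =
      of_nat d * (\<Sum>i=1..r. c i * eigen_minor d \<alpha> \<beta> (a i) (b i))"
    unfolding F_def partial_deriv_power_sum x sum_distrib_left sum_distrib_right eigen_minor_def
      sum_subtractf[symmetric]
    by (intro sum.cong) (simp_all add: algebra_simps)
  moreover have "(\<forall>i\<le>1. \<forall>j\<le>1. poly_eval x (partial_deriv i F) * x j - poly_eval x (partial_deriv j F) * x i = 0)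
      \<longleftrightarrow> poly_eval x (partial_deriv 0 F) * x 1 - poly_eval x (partial_deriv 1 F) * x 0 = 0"
    by (auto simp: One_nat_def le_Suc_eq)
  ultimately show ?thesis using assms(1) by simp
qed

lemma in_span_imageE:
  assumes "finite I" "x \<in> mpoly.span (f ` I)"
  obtains c where "x = (\<Sum>i\<in>I. pscale (c i) (f i))"
proof -
  have "\<exists>c. x = (\<Sum>i\<in>I. pscale (c i) (f i))"
    using assms
  proof (induction I arbitrary: x)
    case empty
    then show ?case by simp
  next
    case (insert j I)
    then obtain k where "x - pscale k (f j) \<in> mpoly.span (f ` I)"
      by (auto simp: mpoly.span_breakdown_eq)
    then obtain c where c: "x - pscale k (f j) = (\<Sum>i\<in>I. pscale (c i) (f i))"
      using insert.IH by blast
    have "(\<Sum>i\<in>I. pscale ((c(j := k)) i) (f i)) = (\<Sum>i\<in>I. pscale (c i) (f i))"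
      using insert.hyps by (intro sum.cong) auto
    then have "x = (\<Sum>i\<in>insert j I. pscale ((c(j := k)) i) (f i))"
      using insert.hyps c by (simp add: algebra_simps)
    then show ?case by blast
  qed
  then show ?thesis using that by blast
qed

text \<open>Over an algebraically closed field the weights can be absorbed into the linear forms.\<close>

lemma power_sum_absorb_weights:
  assumes "d \<noteq> 0"
  obtains u v where "power_sum d r c a b = (\<Sum>i=1..r. linear_form (u i) (v i) ^ d)"
proof -
  have "\<exists>z. z ^ d = c i" for i using exists_complex_root[OF assms] by metis
  then obtain z where z: "\<And>i. z i ^ d = c i" by metis
  have "power_sum d r c a b = (\<Sum>i=1..r. linear_form (z i * a i) (z i * b i) ^ d)"
    by (simp add: power_sum_def z flip: pscale_linear_form add: pscale_power)
  then show ?thesis using that[of "\<lambda>i. z i * a i" "\<lambda>i. z i * b i"] by blast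
qed

lemma waring_rank_power_sum_le:
  assumes "d \<noteq> 0"
  shows "waring_rank 1 d (power_sum d r c a b) \<le> r"
proof -
  obtain u v where "power_sum d r c a b = (\<Sum>i=1..r. linear_form (u i) (v i) ^ d)"
    using power_sum_absorb_weights[OF assms] .
  then show ?thesis
    unfolding waring_rank_def
    by (intro Least_le exI[of _ "\<lambda>i. linear_form (u i) (v i)"]) (simp add: linear_form_in_forms)
qed

lemma waring_rank_power_sum_eq:
  assumes "d \<noteq> 0" "2 * r \<le> d + 1"
    and "\<And>i. i \<in> {1..r} \<Longrightarrow> c i \<noteq> 0"
    and "\<And>i. i \<in> {1..r} \<Longrightarrow> (a i, b i) \<noteq> (0, 0)"
    and "\<And>i j. i \<in> {1..r} \<Longrightarrow> j \<in> {1..r} \<Longrightarrow> i \<noteq> j \<Longrightarrow> a i * b j - a j * b i \<noteq> 0"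
  shows "waring_rank 1 d (power_sum d r c a b) = r"
proof (rule antisym)
  let ?F = "power_sum d r c a b"
  let ?P = "\<lambda>s. \<exists>L. (\<forall>i\<in>{1..s}. L i \<in> forms 1 1) \<and> ?F = (\<Sum>i=1..s. L i ^ d)"
  show "waring_rank 1 d ?F \<le> r" using waring_rank_power_sum_le[OF assms(1)] .
  obtain u v where "?F = (\<Sum>i=1..r. linear_form (u i) (v i) ^ d)"
    using power_sum_absorb_weights[OF assms(1)] .
  then have "?P r" by (intro exI[of _ "\<lambda>i. linear_form (u i) (v i)"]) (simp add: linear_form_in_forms)
  then have "?P (waring_rank 1 d ?F)" unfolding waring_rank_def by (rule LeastI)
  then obtain s L where s: "s = waring_rank 1 d ?F" and L: "\<And>i. i \<in> {1..s} \<Longrightarrow> L i \<in> forms 1 1"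
    and F: "?F = (\<Sum>i=1..s. L i ^ d)" by blast
  have "\<exists>u v. L i = linear_form u v" if "i \<in> {1..s}" for i using forms_1_1E[OF L[OF that]] by metis
  then obtain u v where "\<And>i. i \<in> {1..s} \<Longrightarrow> L i = linear_form (u i) (v i)" by metis
  then have "?F = power_sum d s (\<lambda>_. 1) u v" unfolding F unfolding power_sum_def by (intro sum.cong) auto
  then show "r \<le> waring_rank 1 d ?F" using power_sum_length_minimal[OF assms(2-5)] s by simp
qed

lemma waring_rank_le_of_sigma_open:
  assumes "d \<noteq> 0" "proj_point F \<in> sigma_open 1 d r"
  shows "waring_rank 1 d F \<le> r"
proof -
  obtain p where p: "p \<in> {1..r} \<rightarrow> veronese 1 d" "proj_point F \<in> proj_span (p ` {1..r})"
    using assms(2) by (auto simp: sigma_open_def)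
  obtain G where G: "proj_point F = proj_point G" "G \<in> mpoly.span (\<Union>(p ` {1..r}))"
    using p(2) by (auto simp: proj_span_def proj_space_def)
  have "\<exists>a b. p i = proj_point (linear_form a b ^ d)" if "i \<in> {1..r}" for i
  proof -
    have "p i \<in> veronese 1 d" using p(1) that by blast
    then obtain L where "p i = proj_point (L ^ d)" "L \<in> forms 1 1" unfolding veronese_def by blast
    then show ?thesis using forms_1_1E by metis
  qed
  then obtain a b where ab: "\<And>i. i \<in> {1..r} \<Longrightarrow> p i = proj_point (linear_form (a i) (b i) ^ d)" by metis
  let ?S = "mpoly.span ((\<lambda>i. linear_form (a i) (b i) ^ d) ` {1..r})"
  have "\<Union>(p ` {1..r}) \<subseteq> ?S"
    by (auto simp: ab proj_point_def intro!: mpoly.span_scale intro: mpoly.span_base)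
  then have "mpoly.span (\<Union>(p ` {1..r})) \<subseteq> ?S"
    by (intro mpoly.span_minimal mpoly.subspace_span)
  moreover obtain k where "F = pscale k G" using G(1) by (blast elim: proj_point_eqD)
  ultimately have "F \<in> ?S" using G(2) by (auto intro: mpoly.span_scale)
  then obtain c where "F = (\<Sum>i\<in>{1..r}. pscale (c i) (linear_form (a i) (b i) ^ d))"
    by (rule in_span_imageE[rotated]) auto
  then show ?thesis using waring_rank_power_sum_le[OF assms(1)] by (metis power_sum_def)
qed

definition critical_points :: "nat \<Rightarrow> nat \<Rightarrow> nat \<Rightarrow> nat mpoly set set" where
  "critical_points n d r = {proj_point F | F. F \<in> forms n d \<and> F \<noteq> 0 \<and> proj_point F \<in> sigma_open n d r \<and>
     waring_locus n d F \<inter> eigenpoints n F \<noteq> {}}"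

text \<open>A minimal decomposition through an eigenpoint may have fewer than \<open>r\<close> terms; it is padded with
  zero forms.\<close>

lemma critical_points_power_sumE:
  assumes "d \<noteq> 0" "1 \<le> r" "x \<in> critical_points 1 d r"
  obtains c a b where "x = proj_point (power_sum d r c a b)" "power_sum d r c a b \<noteq> 0"
    "(a 1, b 1) \<noteq> (0, 0)" "first_is_eigenvector d r c a b"
proof -
  obtain F where F: "x = proj_point F" "F \<noteq> 0" "proj_point F \<in> sigma_open 1 d r"
    "waring_locus 1 d F \<inter> eigenpoints 1 F \<noteq> {}"
    using assms(3) by (auto simp: critical_points_def)
  let ?s = "waring_rank 1 d F"
  have s: "?s \<le> r" using waring_rank_le_of_sigma_open[OF assms(1) F(3)] .
  from F(4) obtain L L' where LL': "proj_point L = proj_point L'" "proj_point L \<in> waring_locus 1 d F"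
    and L': "L' \<in> forms 1 1" "L' \<noteq> 0" "\<forall>i\<le>1. \<forall>j\<le>1.
        poly_eval (coeff_vector L') (partial_deriv i F) * coeff_vector L' j
        - poly_eval (coeff_vector L') (partial_deriv j F) * coeff_vector L' i = 0"
    unfolding eigenpoints_def Let_def by blast
  from LL'(2) obtain L\<^sub>0 M where "proj_point L = proj_point L\<^sub>0"
    and M: "\<And>i. i \<in> {2..?s} \<Longrightarrow> M i \<in> forms 1 1"
    and span: "F \<in> mpoly.span (insert (L\<^sub>0 ^ d) ((\<lambda>i. M i ^ d) ` {2..?s}))"
    unfolding waring_locus_def by blast
  with LL'(1) obtain k where k: "L\<^sub>0 = pscale k L'" by (metis proj_point_eqD)
  define N where "N i = (if i = 1 then L' else if i \<le> ?s then M i else 0)" for i :: nat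
  have "N i \<in> forms 1 1" if "i \<in> {1..r}" for i
    using L'(1) M[of i] that linear_form_in_forms[of 0 0] by (auto simp: N_def linear_form_0)
  then have "\<exists>u v. N i = linear_form u v" if "i \<in> {1..r}" for i using that forms_1_1E by metis
  then obtain a b where N: "\<And>i. i \<in> {1..r} \<Longrightarrow> N i = linear_form (a i) (b i)" by metis
  let ?S = "mpoly.span ((\<lambda>i. linear_form (a i) (b i) ^ d) ` {1..r})"
  have base: "N i ^ d \<in> ?S" if "i \<in> {1..r}" for i
    using that by (auto simp: N intro!: mpoly.span_base)
  have "L\<^sub>0 ^ d \<in> ?S"
    using base[of 1] assms(2) by (auto simp: k pscale_power N_def intro!: mpoly.span_scale)
  moreover have "M i ^ d \<in> ?S" if "i \<in> {2..?s}" for i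
    using base[of i] s that by (auto simp: N_def)
  ultimately have "mpoly.span (insert (L\<^sub>0 ^ d) ((\<lambda>i. M i ^ d) ` {2..?s})) \<subseteq> ?S"
    by (intro mpoly.span_minimal mpoly.subspace_span) auto
  with span have "F \<in> ?S" by blast
  then obtain c where "F = (\<Sum>i\<in>{1..r}. pscale (c i) (linear_form (a i) (b i) ^ d))"
    by (rule in_span_imageE[rotated]) auto
  then have Fc: "F = power_sum d r c a b" by (simp add: power_sum_def)
  have L'1: "L' = linear_form (a 1) (b 1)" using N[of 1] assms(2) by (simp add: N_def)
  with L'(2) have nz: "(a 1, b 1) \<noteq> (0, 0)" by (auto simp: linear_form_eq_0_iff)
  have "first_is_eigenvector d r c a b"
    using L'(3) eigen_minors_power_sum[OF assms(1), of "a 1" "b 1" r c a b]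
    unfolding L'1 Fc first_is_eigenvector_def by blast
  then show ?thesis using that[of c a b] F Fc nz by simp
qed

text \<open>The bound on \<open>r\<close> enters here: it forces the rank to be exactly \<open>r\<close>, so that the given
  decomposition is a minimal one and its first linear form lies in the Waring locus.\<close>

lemma power_sum_in_critical_points:
  assumes d: "d \<noteq> 0" "2 * r \<le> d + 1" and r: "1 \<le> r"
    and c: "\<And>i. i \<in> {1..r} \<Longrightarrow> c i \<noteq> 0"
    and nz: "(a 1, b 1) \<noteq> (0, 0)"
    and indep: "\<And>i j. i \<in> {1..r} \<Longrightarrow> j \<in> {1..r} \<Longrightarrow> i \<noteq> j \<Longrightarrow> a i * b j - a j * b i \<noteq> 0"
    and eigen: "first_is_eigenvector d r c a b"
  shows "power_sum d r c a b \<noteq> 0" "proj_point (power_sum d r c a b) \<in> critical_points 1 d r"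
proof -
  let ?F = "power_sum d r c a b" and ?L = "\<lambda>i. linear_form (a i) (b i)"
  have nz': "(a i, b i) \<noteq> (0, 0)" if "i \<in> {1..r}" for i
    using nz indep[of i 1] r that by (cases "i = 1") auto
  have rank: "waring_rank 1 d ?F = r" by (rule waring_rank_power_sum_eq[OF d c nz' indep])
  show F0: "?F \<noteq> 0"
  proof
    assume "?F = 0"
    then have "?F = power_sum d 0 c a b" by (simp add: power_sum_def)
    from power_sum_length_minimal[OF d(2) c nz' indep this] r show False by simp
  qed
  have summand: "pscale (c i) (?L i ^ d) \<in> mpoly.span S" if "?L i ^ d \<in> S" for i S
    using that by (intro mpoly.span_scale mpoly.span_base)
  have "?F \<in> mpoly.span (\<Union>((\<lambda>i. proj_point (?L i ^ d)) ` {1..r}))"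
  proof -
    have "?L i ^ d \<in> proj_point (?L i ^ d)" for i
      by (auto simp: proj_point_def intro!: exI[of _ 1])
    then show ?thesis unfolding power_sum_def by (intro mpoly.span_sum summand) blast
  qed
  then have "proj_point ?F \<in> proj_span ((\<lambda>i. proj_point (?L i ^ d)) ` {1..r})"
    using F0 by (auto simp: proj_span_def proj_space_def)
  moreover have "(\<lambda>i. proj_point (?L i ^ d)) \<in> {1..r} \<rightarrow> veronese 1 d"
  proof
    fix i assume "i \<in> {1..r}"
    then have "linear_form (a i) (b i) \<noteq> 0" using nz' by (auto simp: linear_form_eq_0_iff)
    then show "proj_point (?L i ^ d) \<in> veronese 1 d"
      unfolding veronese_def using linear_form_in_forms by blast
  qed
  ultimately have sigma: "proj_point ?F \<in> sigma_open 1 d r"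
    unfolding sigma_open_def by blast
  have L1: "?L 1 \<in> forms 1 1" "?L 1 \<noteq> 0"
    using nz linear_form_in_forms by (auto simp: linear_form_eq_0_iff)
  have "?F \<in> mpoly.span (insert (?L 1 ^ d) ((\<lambda>i. ?L i ^ d) ` {2..r}))"
    unfolding power_sum_def
  proof (intro mpoly.span_sum summand)
    fix i assume "i \<in> {1..r}"
    then show "?L i ^ d \<in> insert (?L 1 ^ d) ((\<lambda>i. ?L i ^ d) ` {2..r})"
      by (cases "i = 1") auto
  qed
  then have "proj_point (?L 1) \<in> waring_locus 1 d ?F"
    unfolding waring_locus_def rank
    by (intro CollectI exI[of _ "?L 1"] exI[of _ ?L] conjI ballI refl L1 linear_form_in_forms)
  moreover have "proj_point (?L 1) \<in> eigenpoints 1 ?F"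
    unfolding eigenpoints_def Let_def
    using L1 eigen_minors_power_sum[OF d(1), of "a 1" "b 1" r c a b] eigen
    unfolding first_is_eigenvector_def by blast
  ultimately show "proj_point ?F \<in> critical_points 1 d r"
    unfolding critical_points_def using F0 sigma power_sum_in_forms by blast
qed


section \<open>Irreducibility from a polynomial parametrization\<close>

text \<open>Functions that are polynomial along every line behave like an integral domain: they are closed
  under the ring operations, and two of them that are not identically zero are simultaneously
  nonzero somewhere on the line joining a point of nonvanishing of each.\<close>

definition poly_on_lines :: "(('i \<Rightarrow> complex) \<Rightarrow> complex) \<Rightarrow> bool" where
  "poly_on_lines f \<longleftrightarrow> (\<forall>t u. \<exists>p. \<forall>s. f (\<lambda>i. t i + s * (u i - t i)) = poly p s)"

named_theorems poly_on_lines_intros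

lemma poly_on_lines_const [poly_on_lines_intros]: "poly_on_lines (\<lambda>_. c)"
  unfolding poly_on_lines_def by (intro allI exI[of _ "[:c:]"]) simp

lemma poly_on_lines_coordinate [poly_on_lines_intros]: "poly_on_lines (\<lambda>t. t i)"
  unfolding poly_on_lines_def
proof (intro allI)
  fix t u :: "'a \<Rightarrow> complex"
  show "\<exists>p. \<forall>s. t i + s * (u i - t i) = poly p s" by (intro exI[of _ "[:t i, u i - t i:]"]) simp
qed

lemma poly_on_lines_add [poly_on_lines_intros]:
  "poly_on_lines f \<Longrightarrow> poly_on_lines g \<Longrightarrow> poly_on_lines (\<lambda>t. f t + g t)"
  unfolding poly_on_lines_def by (metis poly_add)

lemma poly_on_lines_mult [poly_on_lines_intros]:
  "poly_on_lines f \<Longrightarrow> poly_on_lines g \<Longrightarrow> poly_on_lines (\<lambda>t. f t * g t)"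
  unfolding poly_on_lines_def by (metis poly_mult)

lemma poly_on_lines_uminus [poly_on_lines_intros]: "poly_on_lines f \<Longrightarrow> poly_on_lines (\<lambda>t. - f t)"
  unfolding poly_on_lines_def by (metis poly_minus)

lemma poly_on_lines_diff [poly_on_lines_intros]:
  "poly_on_lines f \<Longrightarrow> poly_on_lines g \<Longrightarrow> poly_on_lines (\<lambda>t. f t - g t)"
  unfolding poly_on_lines_def by (metis poly_diff)

lemma poly_on_lines_power [poly_on_lines_intros]: "poly_on_lines f \<Longrightarrow> poly_on_lines (\<lambda>t. f t ^ n)"
  unfolding poly_on_lines_def by (metis poly_power)

lemma poly_on_lines_sum [poly_on_lines_intros]:
  "(\<And>i. i \<in> I \<Longrightarrow> poly_on_lines (f i)) \<Longrightarrow> poly_on_lines (\<lambda>t. \<Sum>i\<in>I. f i t)"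
  by (induction I rule: infinite_finite_induct) (auto intro!: poly_on_lines_intros)

lemma poly_on_lines_prod [poly_on_lines_intros]:
  "(\<And>i. i \<in> I \<Longrightarrow> poly_on_lines (f i)) \<Longrightarrow> poly_on_lines (\<lambda>t. \<Prod>i\<in>I. f i t)"
  by (induction I rule: infinite_finite_induct) (auto intro!: poly_on_lines_intros)

lemma poly_on_lines_common_nonzero:
  assumes "poly_on_lines f" "poly_on_lines g" "f t \<noteq> 0" "g u \<noteq> 0"
  obtains w where "f w \<noteq> 0" "g w \<noteq> 0"
proof -
  let ?w = "\<lambda>s i. t i + s * (u i - t i)"
  obtain p where p: "\<And>s. f (?w s) = poly p s"
    using assms(1) unfolding poly_on_lines_def by blast
  obtain q where q: "\<And>s. g (?w s) = poly q s"
    using assms(2) unfolding poly_on_lines_def by blast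
  have "p \<noteq> 0" using p[of 0] assms(3) by auto
  moreover have "q \<noteq> 0" using q[of 1] assms(4) by auto
  ultimately have "p * q \<noteq> 0" by simp
  then obtain s where "poly (p * q) s \<noteq> 0" using poly_all_0_iff_0 by blast
  then show ?thesis using that[of "?w s"] by (simp add: p q)
qed

lemma poly_on_lines_poly_eval:
  assumes "\<And>m. poly_on_lines (\<lambda>t. x t m)"
  shows "poly_on_lines (\<lambda>t. poly_eval (x t) f)"
  unfolding poly_eval_def monom_eval_def by (intro poly_on_lines_intros assms)

text \<open>If \<open>f\<close> and \<open>g\<close> cut out closed sets \<open>A\<close> and \<open>B\<close>, neither of which contains \<open>E\<close>, then
  \<open>f \<circ> \<phi>\<close>, \<open>g \<circ> \<phi>\<close> and the genericity condition \<open>D\<close> are nonzero simultaneously at some parameter,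
  whose image lies in \<open>E\<close> but not in \<open>A \<union> B\<close>.\<close>

lemma irreducible_closure_of_parametrized:
  fixes \<phi> :: "('i \<Rightarrow> complex) \<Rightarrow> nat mpoly"
  assumes forms: "\<And>t. \<phi> t \<in> forms n d"
    and coeffs: "\<And>m. poly_on_lines (\<lambda>t. coeff_at (\<phi> t) m)"
    and covers: "\<And>x. x \<in> E \<Longrightarrow> \<exists>t. \<phi> t \<noteq> 0 \<and> x = proj_point (\<phi> t)"
    and D: "poly_on_lines D" "D t\<^sub>0 \<noteq> 0"
    and generic: "\<And>t. D t \<noteq> 0 \<Longrightarrow> \<phi> t \<noteq> 0 \<and> proj_point (\<phi> t) \<in> E"
  shows "irreducible_space (subtopology (zariski n d) (zariski n d closure_of E))"
proof -
  let ?X = "zariski n d" and ?W = "zariski n d closure_of E"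
  have "E \<subseteq> topspace ?X"
    using covers forms by (auto simp: proj_space_def)
  then have EW: "E \<subseteq> ?W" by (rule closure_of_subset)
  have top: "topspace (subtopology ?X ?W) = ?W"
    using closure_of_subset_topspace[of ?X E] by auto
  have "E \<noteq> {}" using generic[OF D(2)] by blast
  moreover have "A = ?W \<or> B = ?W"
    if AB: "closedin (subtopology ?X ?W) A" "closedin (subtopology ?X ?W) B" "?W = A \<union> B" for A B
  proof -
    have cl: "closedin ?X A" "closedin ?X B"
      using AB(1,2) closedin_trans_full closedin_closure_of by blast+
    then obtain S T where S: "S \<subseteq> coord_polys n d" "A = proj_zeros n d S"
      and T: "T \<subseteq> coord_polys n d" "B = proj_zeros n d T"
      unfolding closedin_zariski by blast
    have "E \<subseteq> A \<or> E \<subseteq> B"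
    proof (rule ccontr)
      assume "\<not> ?thesis"
      then obtain x y where "x \<in> E" "x \<notin> A" "y \<in> E" "y \<notin> B" by blast
      then obtain t u where t: "\<phi> t \<noteq> 0" "proj_point (\<phi> t) \<notin> A"
        and u: "\<phi> u \<noteq> 0" "proj_point (\<phi> u) \<notin> B"
        using covers by metis
      obtain f where f: "f \<in> S" "poly_eval (coeff_at (\<phi> t)) f \<noteq> 0"
        using t(2) in_proj_zeros_iff[OF S(1) forms t(1)] unfolding S(2) by blast
      obtain g where g: "g \<in> T" "poly_eval (coeff_at (\<phi> u)) g \<noteq> 0"
        using u(2) in_proj_zeros_iff[OF T(1) forms u(1)] unfolding T(2) by blast
      let ?f = "\<lambda>t. poly_eval (coeff_at (\<phi> t)) f" and ?g = "\<lambda>t. poly_eval (coeff_at (\<phi> t)) g"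
      have pol: "poly_on_lines ?f" "poly_on_lines ?g"
        by (rule poly_on_lines_poly_eval[where x = "\<lambda>t. coeff_at (\<phi> t)", OF coeffs])+
      obtain v where "?f v \<noteq> 0" "?g v \<noteq> 0"
        using poly_on_lines_common_nonzero[where f = ?f and g = ?g, OF pol f(2) g(2)] .
      then have v: "?f v * ?g v \<noteq> 0" by simp
      have "poly_on_lines (\<lambda>t. ?f t * ?g t)"
        by (rule poly_on_lines_mult[where f = ?f and g = ?g, OF pol])
      from poly_on_lines_common_nonzero[where f = "\<lambda>t. ?f t * ?g t" and g = D, OF this D(1) v D(2)]
      obtain w where w: "?f w * ?g w \<noteq> 0" "D w \<noteq> 0" .
      then have nz: "\<phi> w \<noteq> 0" and "proj_point (\<phi> w) \<in> A \<union> B"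
        using generic[OF w(2)] EW AB(3) by blast+
      then have "?f w = 0 \<or> ?g w = 0"
        using f(1) g(1) in_proj_zeros_iff[OF S(1) forms nz] in_proj_zeros_iff[OF T(1) forms nz]
        unfolding S(2) T(2) by blast
      then show False using w(1) by simp
    qed
    then have "?W \<subseteq> A \<or> ?W \<subseteq> B" using cl closure_of_minimal by metis
    then show ?thesis using AB(3) by blast
  qed
  ultimately show ?thesis
    unfolding irreducible_space_def top using EW by blast
qed

lemma poly_on_lines_power_sum:
  assumes "\<And>i. i \<in> {1..r} \<Longrightarrow> poly_on_lines (A i)" "\<And>i. i \<in> {1..r} \<Longrightarrow> poly_on_lines (B i)"
    "\<And>i. i \<in> {1..r} \<Longrightarrow> poly_on_lines (C i)"
  shows "poly_on_lines (\<lambda>t. coeff_at (power_sum d r (\<lambda>i. C i t) (\<lambda>i. A i t) (\<lambda>i. B i t)) m)"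
proof -
  have "poly_on_lines (\<lambda>t. case_nat (A i t) (\<lambda>_. B i t) j)" if "i \<in> {1..r}" for i j
    using assms(1,2)[OF that] by (cases j) simp_all
  then show ?thesis
    unfolding power_sum_def lookup_sum lookup_pscale lookup_power_linear_form monom_eval_def
    by (cases "m \<in> monoms {..1} d") (auto intro!: poly_on_lines_intros assms)
qed

text \<open>The last three hypotheses provide one parameter at which the given power sum has nonzero weights
  and pairwise independent linear forms; this then holds generically, and generic power sums of the
  family are critical by the lemma on minimal decompositions.\<close>

lemma WE_irreducible_of_parametrization:
  fixes A B C :: "nat \<Rightarrow> ('i \<Rightarrow> complex) \<Rightarrow> complex" and d r :: nat
  defines "\<phi> \<equiv> \<lambda>t. power_sum d r (\<lambda>i. C i t) (\<lambda>i. A i t) (\<lambda>i. B i t)"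
  assumes dr: "d \<noteq> 0" "2 * r \<le> d + 1" "1 \<le> r"
    and pol: "\<And>i. i \<in> {1..r} \<Longrightarrow> poly_on_lines (A i)" "\<And>i. i \<in> {1..r} \<Longrightarrow> poly_on_lines (B i)"
      "\<And>i. i \<in> {1..r} \<Longrightarrow> poly_on_lines (C i)"
    and eigen: "\<And>t. first_is_eigenvector d r (\<lambda>i. C i t) (\<lambda>i. A i t) (\<lambda>i. B i t)"
    and covers: "\<And>c a b. (a 1, b 1) \<noteq> (0, 0) \<Longrightarrow> first_is_eigenvector d r c a b \<Longrightarrow>
      \<exists>t. power_sum d r c a b = \<phi> t"
    and generic: "A 1 t\<^sub>0 \<noteq> 0" "\<And>i. i \<in> {1..r} \<Longrightarrow> C i t\<^sub>0 \<noteq> 0"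
      "\<And>i j. i \<in> {1..r} \<Longrightarrow> j \<in> {1..r} \<Longrightarrow> i \<noteq> j \<Longrightarrow> A i t\<^sub>0 * B j t\<^sub>0 - A j t\<^sub>0 * B i t\<^sub>0 \<noteq> 0"
  shows "irreducible_space (subtopology (zariski 1 d) (WE 1 d r))"
proof -
  define D where "D t = A 1 t * (\<Prod>i\<in>{1..r}. C i t) *
    (\<Prod>i\<in>{1..r}. \<Prod>j\<in>{1..r} - {i}. A i t * B j t - A j t * B i t)" for t
  have D_iff: "D t \<noteq> 0 \<longleftrightarrow> A 1 t \<noteq> 0 \<and> (\<forall>i\<in>{1..r}. C i t \<noteq> 0) \<and>
      (\<forall>i\<in>{1..r}. \<forall>j\<in>{1..r}. i \<noteq> j \<longrightarrow> A i t * B j t - A j t * B i t \<noteq> 0)" for t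
    by (auto simp: D_def)
  have "irreducible_space (subtopology (zariski 1 d) (zariski 1 d closure_of critical_points 1 d r))"
  proof (rule irreducible_closure_of_parametrized[where \<phi> = \<phi> and D = D and t\<^sub>0 = t\<^sub>0])
    show "\<phi> t \<in> forms 1 d" for t unfolding \<phi>_def by (rule power_sum_in_forms)
    show "poly_on_lines (\<lambda>t. coeff_at (\<phi> t) m)" for m
      unfolding \<phi>_def by (intro poly_on_lines_power_sum pol)
    show "\<exists>t. \<phi> t \<noteq> 0 \<and> x = proj_point (\<phi> t)" if "x \<in> critical_points 1 d r" for x
      using critical_points_power_sumE[OF dr(1,3) that] covers by metis
    show "poly_on_lines D"
      unfolding D_def using dr(3) by (intro poly_on_lines_intros pol) auto
    show "D t\<^sub>0 \<noteq> 0" unfolding D_iff using generic by blast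
    show "\<phi> t \<noteq> 0 \<and> proj_point (\<phi> t) \<in> critical_points 1 d r" if "D t \<noteq> 0" for t
      using that unfolding D_iff \<phi>_def
      by (intro conjI power_sum_in_critical_points[OF dr] eigen) auto
  qed
  then show ?thesis by (simp add: WE_def critical_points_def)
qed


section \<open>Parametrizing the critical points\<close>

lemma proportional_if_det_zero:
  fixes a b u v :: complex
  assumes "(a, b) \<noteq> (0, 0)" "u * b - v * a = 0"
  obtains k where "u = k * a" "v = k * b"
proof (cases "a = 0")
  case True
  then show ?thesis using assms that[of "v / b"] by auto
next
  case False
  then show ?thesis using assms that[of "u / a"] by (auto simp: field_simps)
qed

text \<open>A summand that satisfies the eigenvector condition on its own belongs to a linear form that is
  proportional or orthogonal to the first one.\<close>

lemma power_sum_collapse: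
  assumes d: "d \<ge> 2" and nz: "(a 1, b 1) \<noteq> (0, 0)"
    and zero: "\<And>i. i \<in> {1..r} \<Longrightarrow> c i * eigen_minor d (a 1) (b 1) (a i) (b i) = 0"
  obtains k l where "power_sum d r c a b =
    pscale k (linear_form (a 1) (b 1) ^ d) + pscale l (linear_form (- b 1) (a 1) ^ d)"
proof -
  let ?P = "linear_form (a 1) (b 1) ^ d" and ?Q = "linear_form (- b 1) (a 1) ^ d"
  have mult: "linear_form (k * x) (k * y) ^ d = pscale (k ^ d) (linear_form x y ^ d)" for k x y
    by (simp add: pscale_power flip: pscale_linear_form)
  have "pscale (c i) (linear_form (a i) (b i) ^ d) \<in> mpoly.span {?P, ?Q}" if i: "i \<in> {1..r}" for i
  proof -
    consider "c i = 0" | "a i * b 1 - b i * a 1 = 0" | "a i * a 1 - b i * (- b 1) = 0"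
      using zero[OF i] d by (auto simp: eigen_minor_def mult_ac)
    then show ?thesis
    proof cases
      case 1
      then show ?thesis by (simp add: mpoly.span_zero)
    next
      case 2
      obtain k where "a i = k * a 1" "b i = k * b 1" using proportional_if_det_zero[OF nz 2] .
      then show ?thesis by (simp add: mult mpoly.span_scale mpoly.span_base)
    next
      case 3
      have "(- b 1, a 1) \<noteq> (0, 0)" using nz by auto
      then obtain k where "a i = k * (- b 1)" "b i = k * a 1" by (rule proportional_if_det_zero[OF _ 3])
      then show ?thesis by (simp only: mult) (simp add: mpoly.span_scale mpoly.span_base)
    qed
  qed
  then have "power_sum d r c a b \<in> mpoly.span {?P, ?Q}"
    unfolding power_sum_def by (rule mpoly.span_sum)
  then obtain k l where "power_sum d r c a b - pscale k ?P - pscale l ?Q = 0"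
    by (auto simp: mpoly.span_breakdown_eq)
  then show ?thesis using that[of k l] by (simp add: algebra_simps)
qed

text \<open>Each of the two factors of the minor is a power of a nonzero linear form in \<open>(u, v)\<close>, so it kills at most
  one of the pairwise independent vectors \<open>(1, 0)\<close>, \<open>(0, 1)\<close>, \<open>(1, 1)\<close>.\<close>

lemma eigen_minor_nonzero_exists:
  assumes "(a, b) \<noteq> (0, 0)"
  obtains u v where "eigen_minor d a b u v \<noteq> 0"
proof -
  consider "a = 0" | "b = 0" | "a \<noteq> 0" "b \<noteq> 0" by blast
  then show ?thesis
  proof cases
    case 1
    then show ?thesis using assms by (intro that[of 1 1]) (simp add: eigen_minor_def)
  next
    case 2
    then show ?thesis using assms by (intro that[of 1 1]) (simp add: eigen_minor_def)
  next
    case 3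
    then show ?thesis by (intro that[of 1 0]) (simp add: eigen_minor_def)
  qed
qed

text \<open>If all coefficients of the eigenvector condition vanish, the sum collapses to two powers,
  and with \<open>r \<ge> 3\<close> there is room for an additional linear form of weight zero.\<close>

lemma power_sum_second_minor_nonzero:
  assumes d: "d \<ge> 2" and r: "r \<ge> 3" and nz: "(a 1, b 1) \<noteq> (0, 0)"
    and eigen: "first_is_eigenvector d r c a b"
  obtains c' a' b' where "power_sum d r c' a' b' = power_sum d r c a b"
    "first_is_eigenvector d r c' a' b'" "eigen_minor d (a' 1) (b' 1) (a' 2) (b' 2) \<noteq> 0"
proof (cases "\<exists>i\<in>{1..r}. eigen_minor d (a 1) (b 1) (a i) (b i) \<noteq> 0")
  case True
  then obtain i where i: "i \<in> {1..r}" "eigen_minor d (a 1) (b 1) (a i) (b i) \<noteq> 0" by blast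
  then have "i \<noteq> 1" by auto
  let ?\<pi> = "Transposition.transpose 2 i"
  have \<pi>: "?\<pi> permutes {1..r}" using i(1) r by (intro permutes_swap_id) auto
  have \<pi>1: "?\<pi> 1 = 1" using \<open>i \<noteq> 1\<close> by (simp add: transpose_def)
  show ?thesis
  proof (rule that[of "c \<circ> ?\<pi>" "a \<circ> ?\<pi>" "b \<circ> ?\<pi>"])
    show "power_sum d r (c \<circ> ?\<pi>) (a \<circ> ?\<pi>) (b \<circ> ?\<pi>) = power_sum d r c a b"
      unfolding power_sum_def by (subst (2) sum.permute[OF \<pi>]) (simp add: o_def)
    show "first_is_eigenvector d r (c \<circ> ?\<pi>) (a \<circ> ?\<pi>) (b \<circ> ?\<pi>)"
      using eigen unfolding first_is_eigenvector_def by (subst (asm) sum.permute[OF \<pi>]) (simp add: o_def \<pi>1)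
    show "eigen_minor d ((a \<circ> ?\<pi>) 1) ((b \<circ> ?\<pi>) 1) ((a \<circ> ?\<pi>) 2) ((b \<circ> ?\<pi>) 2) \<noteq> 0"
      using i(2) by (simp add: \<pi>1)
  qed
next
  case False
  then have "c i * eigen_minor d (a 1) (b 1) (a i) (b i) = 0" if "i \<in> {1..r}" for i using that by auto
  then obtain k l where kl: "power_sum d r c a b =
      pscale k (linear_form (a 1) (b 1) ^ d) + pscale l (linear_form (- b 1) (a 1) ^ d)"
    using power_sum_collapse[where a = a and b = b, OF d nz] by blast
  obtain u v where uv: "eigen_minor d (a 1) (b 1) u v \<noteq> 0" using eigen_minor_nonzero_exists[OF nz] .
  \<comment> \<open>The orthogonal form moves to place \<open>3\<close>; place \<open>2\<close> has weight \<open>0\<close>.\<close>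
  let ?c = "(\<lambda>_::nat. 0)(1 := k, 3 := l)"
  let ?a = "(\<lambda>_::nat. 0)(1 := a 1, 2 := u, 3 := - b 1)" and ?b = "(\<lambda>_::nat. 0)(1 := b 1, 2 := v, 3 := a 1)"
  have split: "{1..r} = insert 1 (insert 2 (insert 3 {4..r}))" using r by auto
  show ?thesis
  proof (rule that[of ?c ?a ?b])
    show "power_sum d r ?c ?a ?b = power_sum d r c a b"
      unfolding kl unfolding power_sum_def split by (simp add: sum.neutral)
    show "first_is_eigenvector d r ?c ?a ?b"
      unfolding first_is_eigenvector_def split using d by (simp add: sum.neutral eigen_minor_def)
    show "eigen_minor d (?a 1) (?b 1) (?a 2) (?b 2) \<noteq> 0" using uv by simp
  qed
qed

lemma WE_irreducible_1:
  assumes "d \<ge> 2"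
  shows "irreducible_space (subtopology (zariski 1 d) (WE 1 d 1))"
proof (rule WE_irreducible_of_parametrization[where A = "\<lambda>_ t. t (0::nat)" and B = "\<lambda>_ t. t 1"
      and C = "\<lambda>_ t. t 2" and t\<^sub>0 = "\<lambda>_. 1"])
  fix c a b :: "nat \<Rightarrow> complex"
  show "\<exists>t. power_sum d 1 c a b = power_sum d 1 (\<lambda>_. t 2) (\<lambda>_. t (0::nat)) (\<lambda>_. t 1)"
    by (rule exI[of _ "(\<lambda>_. 0)(0 := a 1, 1 := b 1, 2 := c 1)"]) (simp add: power_sum_def)
qed (use assms in \<open>auto simp: first_is_eigenvector_def intro!: poly_on_lines_intros\<close>)

text \<open>For \<open>r = 2\<close> the condition is the vanishing of a single product, so every critical form is a
  combination of \<open>(a x\<^sub>0 + b x\<^sub>1)\<^sup>d\<close> and the power of the orthogonal form \<open>- b x\<^sub>0 + a x\<^sub>1\<close>.\<close>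

lemma WE_irreducible_2:
  assumes d: "d \<ge> 2" "2 * 2 \<le> d + 1"
  shows "irreducible_space (subtopology (zariski 1 d) (WE 1 d 2))"
proof -
  define A where "A i t = (if i = 1 then t (0::nat) else - t 1)" for i :: nat and t :: "nat \<Rightarrow> complex"
  define B where "B i t = (if i = 1 then t (1::nat) else t 0)" for i :: nat and t :: "nat \<Rightarrow> complex"
  define C where "C i t = (if i = 1 then t (2::nat) else t 3)" for i :: nat and t :: "nat \<Rightarrow> complex"
  have two: "{1..2} = {1, 2::nat}" by auto
  show ?thesis
  proof (rule WE_irreducible_of_parametrization[where A = A and B = B and C = C and t\<^sub>0 = "\<lambda>_. 1"])
    show "poly_on_lines (A i)" "poly_on_lines (B i)" "poly_on_lines (C i)" for i
      unfolding A_def B_def C_def by (cases "i = 1"; auto intro!: poly_on_lines_intros)+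
    show "first_is_eigenvector d 2 (\<lambda>i. C i t) (\<lambda>i. A i t) (\<lambda>i. B i t)" for t
      using d by (simp add: first_is_eigenvector_def two A_def B_def C_def eigen_minor_def)
    fix c a b assume nz: "(a 1, b 1) \<noteq> (0, 0)" and "first_is_eigenvector d 2 c a b"
    then have "c i * eigen_minor d (a 1) (b 1) (a i) (b i) = 0" if "i \<in> {1..2}" for i
      using that by (auto simp: first_is_eigenvector_def two)
    then obtain k l where kl: "power_sum d 2 c a b =
        pscale k (linear_form (a 1) (b 1) ^ d) + pscale l (linear_form (- b 1) (a 1) ^ d)"
      using power_sum_collapse[where a = a and b = b, OF d(1) nz] by blast
    show "\<exists>t. power_sum d 2 c a b = power_sum d 2 (\<lambda>i. C i t) (\<lambda>i. A i t) (\<lambda>i. B i t)"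
      by (rule exI[of _ "(\<lambda>_. 0)(0 := a 1, 1 := b 1, 2 := k, 3 := l)"])
        (unfold kl, simp add: power_sum_def two A_def B_def C_def)
  qed (use d in \<open>auto simp: two A_def B_def C_def\<close>)
qed

text \<open>For \<open>r \<ge> 3\<close> the eigenvector condition is linear in the weights and can be solved for the second
  one. Multiplying all weights by its coefficient \<open>Q 2\<close> clears the denominator, so that the
  parametrization is polynomial.\<close>

lemma WE_irreducible_ge_3:
  assumes d: "d \<ge> 2" "2 * r \<le> d + 1" and r: "r \<ge> 3"
  shows "irreducible_space (subtopology (zariski 1 d) (WE 1 d r))"
proof -
  define A where "A i t = t (i, 0)" for i :: nat and t :: "nat \<times> nat \<Rightarrow> complex"
  define B where "B i t = t (i, 1)" for i :: nat and t :: "nat \<times> nat \<Rightarrow> complex"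
  define Q where "Q i t = eigen_minor d (A 1 t) (B 1 t) (A i t) (B i t)" for i t
  define C where "C i t = (if i = 2 then - (\<Sum>j=3..r. t (j, 2) * Q j t) else t (i, 2) * Q 2 t)"
    for i :: nat and t :: "nat \<times> nat \<Rightarrow> complex"
  have split: "{1..r} = insert 1 (insert 2 {3..r})" using r by auto
  have pol: "poly_on_lines (A i)" "poly_on_lines (B i)" "poly_on_lines (Q i)" for i
    unfolding Q_def A_def B_def eigen_minor_def by (intro poly_on_lines_intros)+
  have polC: "poly_on_lines (C i)" for i
    unfolding C_def by (cases "i = 2"; auto intro!: poly_on_lines_intros pol)
  \<comment> \<open>A generic parameter: the points \<open>(1, i)\<close>, all with weight \<open>1\<close>.\<close>
  define t\<^sub>0 :: "nat \<times> nat \<Rightarrow> complex" where "t\<^sub>0 = (\<lambda>(i, k). if k = 1 then of_nat i else 1)"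
  have Q0: "Q i t\<^sub>0 = - of_nat ((1 + i) ^ (d - 1) * (i - 1))" if "i \<ge> 1" for i
    using that by (simp add: Q_def A_def B_def t\<^sub>0_def eigen_minor_def of_nat_diff algebra_simps)
  show ?thesis
  proof (rule WE_irreducible_of_parametrization[where A = A and B = B and C = C and t\<^sub>0 = t\<^sub>0])
    show "first_is_eigenvector d r (\<lambda>i. C i t) (\<lambda>i. A i t) (\<lambda>i. B i t)" for t
    proof -
      have "(\<Sum>i=1..r. C i t * Q i t) = C 2 t * Q 2 t + (\<Sum>i=3..r. C i t * Q i t)"
        unfolding split by (simp add: Q_def)
      also have "(\<Sum>i=3..r. C i t * Q i t) = (\<Sum>i=3..r. t (i, 2) * Q i t) * Q 2 t"
        unfolding sum_distrib_right by (intro sum.cong) (auto simp: C_def)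
      finally show ?thesis by (simp add: first_is_eigenvector_def C_def flip: Q_def)
    qed
    fix c a b assume "(a 1, b 1) \<noteq> (0, 0)" "first_is_eigenvector d r c a b"
    then obtain c' a' b' where F: "power_sum d r c' a' b' = power_sum d r c a b"
      and eigen: "first_is_eigenvector d r c' a' b'" and "eigen_minor d (a' 1) (b' 1) (a' 2) (b' 2) \<noteq> 0"
      using power_sum_second_minor_nonzero[OF d(1) r] by metis
    define q where "q i = eigen_minor d (a' 1) (b' 1) (a' i) (b' i)" for i
    have q2: "q 2 \<noteq> 0" unfolding q_def by fact
    define t :: "nat \<times> nat \<Rightarrow> complex" where "t = (\<lambda>(i, k). if k = 0 then a' i else if k = 1 then b' i else c' i / q 2)"
    have AB: "A i t = a' i" "B i t = b' i" for i by (simp_all add: A_def B_def t_def)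
    have Q: "Q i t = q i" for i by (simp add: Q_def AB q_def)
    have "c' 2 * q 2 + (\<Sum>i=3..r. c' i * q i) = 0"
      using eigen unfolding first_is_eigenvector_def split q_def by simp
    then have "c' 2 * q 2 = - (\<Sum>i=3..r. c' i * q i)" by (simp add: eq_neg_iff_add_eq_0)
    then have "c' 2 = - (\<Sum>i=3..r. c' i * q i) / q 2" using q2 by (simp add: field_simps)
    then have "C i t = c' i" for i
      using q2 by (simp add: C_def Q) (simp add: t_def sum_divide_distrib)
    then show "\<exists>t. power_sum d r c a b = power_sum d r (\<lambda>i. C i t) (\<lambda>i. A i t) (\<lambda>i. B i t)"
      by (intro exI[of _ t]) (simp add: AB F)
  next
    \<comment> \<open>At this parameter \<open>C 2\<close> is a sum of positive integers.\<close>
    show "C i t\<^sub>0 \<noteq> 0" if "i \<in> {1..r}" for i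
    proof (cases "i = 2")
      case True
      have "(\<Sum>j=3..r. t\<^sub>0 (j, 2) * Q j t\<^sub>0) = (\<Sum>j=3..r. - of_nat ((1 + j) ^ (d - 1) * (j - 1)))"
      proof (rule sum.cong[OF refl])
        fix j assume "j \<in> {3..r}"
        then have "Q j t\<^sub>0 = - of_nat ((1 + j) ^ (d - 1) * (j - 1))" by (intro Q0) simp
        then show "t\<^sub>0 (j, 2) * Q j t\<^sub>0 = - of_nat ((1 + j) ^ (d - 1) * (j - 1))"
          by (simp add: t\<^sub>0_def)
      qed
      then have "C 2 t\<^sub>0 = of_nat (\<Sum>j=3..r. (1 + j) ^ (d - 1) * (j - 1))"
        unfolding C_def by (simp only: sum_negf of_nat_sum minus_minus simp_thms if_True)
      moreover have "(\<Sum>j=3..r. (1 + j) ^ (d - 1) * (j - 1)) \<noteq> 0"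
        using r by auto
      ultimately show ?thesis using True by (metis of_nat_eq_0_iff)
    next
      case False
      moreover have "Q 2 t\<^sub>0 \<noteq> 0" by (subst Q0) (simp_all del: of_nat_add of_nat_mult of_nat_power)
      ultimately show ?thesis by (simp add: C_def) (simp add: t\<^sub>0_def)
    qed
  qed (use d r pol polC in \<open>auto simp: A_def B_def t\<^sub>0_def\<close>)
qed

theorem theorem4p12:
  fixes d r :: nat
  assumes "d \<ge> 2" and "1 \<le> r" and "real r \<le> (real d + 1) / 2"
  shows "irreducible_space (subtopology (zariski 1 d) (WE 1 d r))"
proof -
  have "real (2 * r) \<le> real (d + 1)" using assms(3) by simp
  then have "2 * r \<le> d + 1" by (simp only: of_nat_le_iff)
  consider "r = 1" | "r = 2" | "r \<ge> 3" using assms(2) by linarith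
  then show ?thesis
  proof cases
    case 1
    then show ?thesis using WE_irreducible_1[OF assms(1)] by simp
  next
    case 2
    then show ?thesis using WE_irreducible_2[OF assms(1)] \<open>2 * r \<le> d + 1\<close> by simp
  next
    case 3
    then show ?thesis using WE_irreducible_ge_3[OF assms(1) \<open>2 * r \<le> d + 1\<close>] by simp
  qed
qed

end
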